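(* Let $T\in(0,\infty]$ and $0<\gamma<1$. Suppose $\varphi\in L^1_{\mathrm{loc}}[0,T)$, let $\varphi_0\in\mathbb{R}$, and denote by $f=D_c^\gamma\varphi$ the generalized Caputo derivative of $\varphi$ associated with $\varphi_0$, a distribution in $\mathscr D'(-\infty,T)$ supported in $[0,T)$. Then, for Lebesgue a.e. $t\in(0,T)$, $$\varphi(t)=\varphi_0+J_\gamma(f)(t).$$ If moreover $f\in L^1_{\mathrm{loc}}[0,T)$, then for Lebesgue a.e. $t\in(0,T)$, $$\varphi(t)=\varphi_0+\frac{1}{\Gamma(\gamma)}\int_0^t(t-s)^{\gamma-1}f(s)\,ds,$$ where the integral is understood in the Lebesgue sense.
   Context: $L^1_{\mathrm{loc}}[0,T)$ is the set of functions integrable on every compact subset of $[0,T)$; such functions are identified with distributions in $\mathscr D'(-\infty,T)$ by extension by zero to $t<0$. $\theta$ is the Heaviside function, $D$ the distributional derivative, $g_\alpha(t)=\theta(t)t^{\alpha-1}/\Gamma(\alpha)$ for $\alpha>0$, $g_0=\delta$, $g_{-\beta}=\frac{1}{\Gamma(1-\beta)}D(\theta(t)t^{-\beta})$ for $0<\beta<1$. If $v\in\mathscr D'(-\infty,T)$ has support bounded from below, $g_\alpha*v\in\mathscr D'(-\infty,T)$ is defined as follows: for every $R<T$, its restriction to $(-\infty,R)$ equals that of the convolution on $\mathbb{R}$ of $g_\alpha$ with $\chi v$ (extended by zero), where $\chi\in C_c^\infty(-\infty,T)$ equals $1$ in a neighborhood of $\operatorname{supp}v\cap(-\infty,R]$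 (well defined since $\operatorname{supp}g_\alpha\subset[0,\infty)$). For $\varphi\in L^1_{\mathrm{loc}}[0,T)$, $J_\alpha\varphi:=g_\alpha*(\theta\varphi)$; for a distribution $f\in\mathscr D'(-\infty,T)$ supported in $[0,T)$, $J_\alpha f:=g_\alpha*f$. For $\varphi\in L^1_{\mathrm{loc}}[0,T)$ and $\varphi_0\in\mathbb{R}$, the generalized Caputo derivative of order $\gamma\in(0,1)$ associated with $\varphi_0$ is the distribution $D_c^\gamma\varphi:=J_{-\gamma}\varphi-\varphi_0\,g_{1-\gamma}=J_{-\gamma}(\varphi-\varphi_0)$. *)

theory Defs
  imports "HOL-Analysis.Analysis"
begin

text \<open>
  Real distributions on an open set \<open>U\<close> of reals are functionals on functions \<open>real \<Rightarrow> real\<close>; only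
  their values on test functions on \<open>U\<close> matter. A test function on \<open>U\<close> is regarded as defined on
  all of the real line, being zero outside \<open>U\<close>, so restricting a distribution to a smaller open set
  does not change the functional.
\<close>

type_synonym distr = "(real \<Rightarrow> real) \<Rightarrow> real"

definition tsupp :: "(real \<Rightarrow> real) \<Rightarrow> real set" where
  "tsupp \<psi> = closure {x. \<psi> x \<noteq> 0}"

definition smooth :: "(real \<Rightarrow> real) \<Rightarrow> bool" where
  "smooth \<psi> \<longleftrightarrow> (\<forall>k x. (deriv ^^ k) \<psi> field_differentiable at x)"

definition test_fun :: "real set \<Rightarrow> (real \<Rightarrow> real) \<Rightarrow> bool" where
  "test_fun U \<psi> \<longleftrightarrow> smooth \<psi> \<and> compact (tsupp \<psi>) \<and> tsupp \<psi> \<subseteq> U"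

definition distribution :: "real set \<Rightarrow> distr \<Rightarrow> bool" where
  "distribution U u \<longleftrightarrow>
     (\<forall>\<psi>1 \<psi>2 a b. test_fun U \<psi>1 \<longrightarrow> test_fun U \<psi>2 \<longrightarrow>
        u (\<lambda>x. a * \<psi>1 x + b * \<psi>2 x) = a * u \<psi>1 + b * u \<psi>2) \<and>
     (\<forall>K. compact K \<and> K \<subseteq> U \<longrightarrow>
        (\<exists>C N. \<forall>\<psi>. test_fun U \<psi> \<and> tsupp \<psi> \<subseteq> K \<longrightarrow>
           \<bar>u \<psi>\<bar> \<le> C * (\<Sum>k\<le>N. SUP x. \<bar>(deriv ^^ k) \<psi> x\<bar>)))"

definition dsupp :: "real set \<Rightarrow> distr \<Rightarrow> real set" where
  "dsupp U u = U - \<Union>{V. open V \<and> V \<subseteq> U \<and> (\<forall>\<psi>. test_fun V \<psi> \<longrightarrow> u \<psi> = 0)}"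

definition regular :: "(real \<Rightarrow> real) \<Rightarrow> distr" where
  "regular h \<psi> = (LINT x|lebesgue. h x * \<psi> x)"

definition ddirac :: distr where
  "ddirac \<psi> = \<psi> 0"

definition dD :: "distr \<Rightarrow> distr" where
  "dD u \<psi> = - u (deriv \<psi>)"

definition dmult :: "(real \<Rightarrow> real) \<Rightarrow> distr \<Rightarrow> distr" where
  "dmult \<eta> u \<psi> = u (\<lambda>x. \<eta> x * \<psi> x)"

text \<open>
  Convolution on the real line, \<open>\<langle>g * w, \<psi>\<rangle> = \<langle>g\<^sub>x, \<langle>w\<^sub>y, \<psi> (x + y)\<rangle>\<rangle>\<close>, meant for \<open>w\<close> compactly
  supported: then the inner pairing is a test function of \<open>x\<close>.
\<close>

definition dconv :: "distr \<Rightarrow> distr \<Rightarrow> distr" where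
  "dconv g w \<psi> = g (\<lambda>x. w (\<lambda>y. \<psi> (x + y)))"

definition below :: "ereal \<Rightarrow> real set" where
  "below T = {t. ereal t < T}"

definition heaviside :: "real \<Rightarrow> real" where
  "heaviside t = (if t \<ge> 0 then 1 else 0)"

definition L1loc :: "ereal \<Rightarrow> (real \<Rightarrow> real) \<Rightarrow> bool" where
  "L1loc T h \<longleftrightarrow>
     (\<forall>K. compact K \<and> K \<subseteq> {t. 0 \<le> t \<and> ereal t < T} \<longrightarrow> set_integrable lebesgue K h)"

text \<open>The function \<open>h\<close> on \<open>[0, T)\<close>, extended by zero to \<open>t < 0\<close>, as a distribution.\<close>

definition ext0 :: "(real \<Rightarrow> real) \<Rightarrow> distr" where
  "ext0 h = regular (\<lambda>t. heaviside t * h t)"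

definition represents :: "ereal \<Rightarrow> distr \<Rightarrow> (real \<Rightarrow> real) \<Rightarrow> bool" where
  "represents T u h \<longleftrightarrow> L1loc T h \<and> (\<forall>\<psi>. test_fun (below T) \<psi> \<longrightarrow> u \<psi> = ext0 h \<psi>)"

text \<open>
  The distribution \<open>g\<^sub>\<alpha>\<close> on the real line for \<open>\<alpha> > -1\<close>; the last case is
  \<open>g\<^bsub>-\<beta>\<^esub> = D (\<theta> t\<^bsup>-\<beta>\<^esup>) / \<Gamma> (1 - \<beta>)\<close> with \<open>\<beta> = - \<alpha>\<close>.
\<close>

definition gker :: "real \<Rightarrow> distr" where
  "gker \<alpha> =
     (if \<alpha> > 0 then regular (\<lambda>t. heaviside t * t powr (\<alpha> - 1) / Gamma \<alpha>)
      else if \<alpha> = 0 then ddirac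
      else (\<lambda>\<psi>. 1 / Gamma (1 + \<alpha>) * dD (regular (\<lambda>t. heaviside t * t powr \<alpha>)) \<psi>))"

definition cutoff :: "ereal \<Rightarrow> distr \<Rightarrow> real \<Rightarrow> (real \<Rightarrow> real) \<Rightarrow> bool" where
  "cutoff T v R \<eta> \<longleftrightarrow> test_fun (below T) \<eta> \<and>
     (\<exists>V. open V \<and> dsupp (below T) v \<inter> {..R} \<subseteq> V \<and> (\<forall>x\<in>V. \<eta> x = 1))"

text \<open>
  \<open>J T \<alpha> v = g\<^sub>\<alpha> * v\<close> for a distribution \<open>v\<close> on \<open>(-\<infinity>, T)\<close> with support bounded from below: for
  every \<open>R < T\<close> and every admissible cutoff \<open>\<eta>\<close>, its restriction to \<open>(-\<infinity>, R)\<close> is the convolution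
  on the real line of \<open>g\<^sub>\<alpha>\<close> with \<open>\<eta> v\<close>. A given test function on \<open>(-\<infinity>, T)\<close> lives on \<open>(-\<infinity>, R)\<close> for
  some \<open>R < T\<close>, and the common value over all such \<open>R\<close> and \<open>\<eta>\<close> is taken.
\<close>

definition J :: "ereal \<Rightarrow> real \<Rightarrow> distr \<Rightarrow> distr" where
  "J T \<alpha> v \<psi> = (THE c. \<forall>R \<eta>. ereal R < T \<and> test_fun {..<R} \<psi> \<and> cutoff T v R \<eta> \<longrightarrow>
                          c = dconv (gker \<alpha>) (dmult \<eta> v) \<psi>)"

definition gen_caputo :: "ereal \<Rightarrow> real \<Rightarrow> (real \<Rightarrow> real) \<Rightarrow> real \<Rightarrow> distr" where
  "gen_caputo T \<gamma> \<phi> \<phi>0 \<psi> = J T (- \<gamma>) (ext0 \<phi>) \<psi> - \<phi>0 * gker (1 - \<gamma>) \<psi>"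

end

(*
  Only the part of the kernel on (0, R) matters for test functions supported below R, so all
  convolutions reduce to Lebesgue integrals of integrable functions. There the Caputo derivative is
  f = D (g_{1-gamma} * (phi - phi0)), and since g_gamma * g_{1-gamma} = theta (Beta integral), Fubini
  gives g_gamma * f = D (theta * (phi - phi0)) = phi - phi0 as distributions; the du Bois-Reymond
  lemma turns this into equality almost everywhere. If f is a function F, Fubini also gives
  g_gamma * f as the function g_gamma * F. A smooth step function built from exp (-1/x) supplies the
  cutoffs, the telescoping partitions of unity behind the independence of J of the cutoff, and the
  approximations of indicator functions for du Bois-Reymond.
*)
theory Submission
  imports Defs
begin

section \<open>Smooth functions\<close>

text \<open>Distributions are total functionals constrained only on test functions, so the function
  x -> v(\<eta> \<psi>(x + .)) handed to \<open>gker\<close> has to be controlled by hand. What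
  saves the argument is that \<open>gker\<close> reads it only for x >= 0, where translation moves
  the support of \<psi> further to the left: one bound \<open>R\<close> for that support serves
  through both nested convolutions. The kernel of order -\<gamma> is the derivative of the one of
  order 1 - \<gamma>, and the derivative is always carried over to \<psi>. Hence \<phi> is never
  differentiated, and every exchange of integrals concerns products of integrable functions with
  bounded ones. A second obstacle is measurability: \<phi> is only Lebesgue measurable, while Fubini
  and translation are used for Borel functions. For each \<open>R\<close> a Borel version on [0, R]
  takes its place; the exceptional null set depends on \<open>R\<close>, so in the end only rational
  \<open>R\<close> are used.\<close>

lemma smoothI_invariant:
  assumes "f \<in> S"
    and step: "\<And>g. g \<in> S \<Longrightarrow> \<exists>g' \<in> S. \<forall>x. (g has_real_derivative g' x) (at x)"
  shows "smooth f"
proof -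
  have S: "deriv g \<in> S \<and> (\<forall>x. g field_differentiable at x)" if g: "g \<in> S" for g
  proof -
    obtain g' where g': "g' \<in> S" "\<And>x. (g has_real_derivative g' x) (at x)"
      using step[OF g] by blast
    have "deriv g = g'"
      using g'(2) by (auto intro: DERIV_imp_deriv)
    then show ?thesis
      using g' field_differentiable_def by blast
  qed
  \<comment> \<open>\<open>smooth\<close> speaks of all iterated derivatives, so the induction needs
    a whole class closed under differentiation; each closure property below amounts to finding such
    a class.\<close>
  have "(deriv ^^ k) f \<in> S" for k
    by (induction k) (use \<open>f \<in> S\<close> S in auto)
  then show ?thesis
    using S unfolding smooth_def by blast
qed

lemma smooth_deriv: "smooth f \<Longrightarrow> smooth (deriv f)"
  unfolding smooth_def by (metis funpow_Suc_right o_apply)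

lemma smooth_DERIV: "smooth f \<Longrightarrow> (f has_real_derivative deriv f x) (at x)"
  unfolding smooth_def by (metis DERIV_deriv_iff_field_differentiable funpow_0)

lemma smoothI:
  assumes "\<And>x. (f has_real_derivative f' x) (at x)" and "smooth f'"
  shows "smooth f"
  by (rule smoothI_invariant[where S = "insert f (Collect smooth)"])
     (use assms smooth_DERIV smooth_deriv in blast)+

lemma smooth_isCont: "smooth f \<Longrightarrow> isCont f x"
  using smooth_DERIV DERIV_isCont by blast

lemma smooth_measurable: "smooth f \<Longrightarrow> f \<in> borel_measurable borel"
  by (intro borel_measurable_continuous_onI continuous_at_imp_continuous_on) (simp add: smooth_isCont)

lemma smooth_const [simp, intro]: "smooth (\<lambda>x. c)"
  by (rule smoothI_invariant[where S = "range (\<lambda>c x. c)"]) (auto intro!: derivative_eq_intros)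

lemma smooth_add:
  assumes "smooth f" "smooth g"
  shows "smooth (\<lambda>x. f x + g x)"
proof (rule smoothI_invariant[where S = "{\<lambda>x. f x + g x |f g. smooth f \<and> smooth g}"])
  fix h assume "h \<in> {\<lambda>x. f x + g x |f g. smooth f \<and> smooth g}"
  then obtain f g where h: "h = (\<lambda>x. f x + g x)" "smooth f" "smooth g"
    by blast
  then show "\<exists>h'\<in>{\<lambda>x. f x + g x |f g. smooth f \<and> smooth g}. \<forall>x. (h has_real_derivative h' x) (at x)"
    by (intro bexI[where x = "\<lambda>x. deriv f x + deriv g x"])
       (use smooth_deriv smooth_DERIV in \<open>fastforce intro!: derivative_intros\<close>)+
qed (use assms in blast)

text \<open>By the Leibniz rule the derivative of one product is a sum of two; only after closing
  the products of smooth functions under addition is the class stable under differentiation.\<close>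

inductive_set product_sums :: "(real \<Rightarrow> real) set" where
  "smooth f \<Longrightarrow> smooth g \<Longrightarrow> (\<lambda>x. f x * g x) \<in> product_sums"
| "p \<in> product_sums \<Longrightarrow> q \<in> product_sums \<Longrightarrow> (\<lambda>x. p x + q x) \<in> product_sums"

lemma smooth_mult:
  assumes "smooth f" "smooth g"
  shows "smooth (\<lambda>x. f x * g x)"
proof (rule smoothI_invariant[where S = product_sums])
  show "(\<lambda>x. f x * g x) \<in> product_sums"
    using assms by (rule product_sums.intros)
next
  fix h assume "h \<in> product_sums"
  then show "\<exists>h'\<in>product_sums. \<forall>x. (h has_real_derivative h' x) (at x)"
  proof induction
    case (1 f g)
    then have "(\<lambda>x. deriv f x * g x + deriv g x * f x) \<in> product_sums"
      by (intro product_sums.intros smooth_deriv)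
    moreover have "\<forall>x. ((\<lambda>x. f x * g x) has_real_derivative deriv f x * g x + deriv g x * f x) (at x)"
      using 1 by (auto intro!: DERIV_mult smooth_DERIV)
    ultimately show ?case
      by (intro bexI[where x = "\<lambda>x. deriv f x * g x + deriv g x * f x"])
  next
    case (2 p q)
    then obtain p' q' where p: "p' \<in> product_sums" "\<And>x. (p has_real_derivative p' x) (at x)"
        and q: "q' \<in> product_sums" "\<And>x. (q has_real_derivative q' x) (at x)"
      by blast
    then show ?case
      by (intro bexI[where x = "\<lambda>x. p' x + q' x"]) (auto intro!: derivative_intros product_sums.intros)
  qed
qed

text \<open>The chain rule produces a factor \<open>a\<close> at every differentiation; the free
  constant \<open>c\<close> in the class absorbs it.\<close>

lemma smooth_compose_affine:
  assumes "smooth f"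
  shows "smooth (\<lambda>x. f (a * x + b))"
proof (rule smoothI_invariant[where S = "{\<lambda>x. c * f (a * x + b) |c f. smooth f}"])
  show "(\<lambda>x. f (a * x + b)) \<in> {\<lambda>x. c * f (a * x + b) |c f. smooth f}"
    using assms by (force intro: exI[where x = 1])
next
  fix h assume "h \<in> {\<lambda>x. c * f (a * x + b) |c f. smooth f}"
  then obtain c f where h: "h = (\<lambda>x. c * f (a * x + b))" "smooth f"
    by blast
  have "(h has_real_derivative (c * a) * deriv f (a * x + b)) (at x)" for x
    unfolding h(1) by (rule derivative_eq_intros smooth_DERIV[OF h(2), THEN DERIV_chain2] refl | simp)+
  then show "\<exists>h'\<in>{\<lambda>x. c * f (a * x + b) |c f. smooth f}. \<forall>x. (h has_real_derivative h' x) (at x)"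
    using smooth_deriv[OF h(2)] by (intro bexI[where x = "\<lambda>x. (c * a) * deriv f (a * x + b)"]) blast+
qed

text \<open>Each differentiation raises the power of \<open>g\<close> in the denominator by one, so
  the class has to contain all positive powers below arbitrary smooth numerators.\<close>

lemma smooth_divide:
  assumes "smooth f" "smooth g" and nz: "\<And>x. g x \<noteq> 0"
  shows "smooth (\<lambda>x. f x / g x)"
proof (rule smoothI_invariant[where S = "{\<lambda>x. p x / g x ^ Suc n |p n. smooth p}"])
  show "(\<lambda>x. f x / g x) \<in> {\<lambda>x. p x / g x ^ Suc n |p n. smooth p}"
    using assms by (force intro: exI[where x = 0])
next
  fix h assume "h \<in> {\<lambda>x. p x / g x ^ Suc n |p n. smooth p}"
  then obtain p n where h: "h = (\<lambda>x. p x / g x ^ Suc n)" "smooth p"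
    by blast
  let ?q = "\<lambda>x. deriv p x * g x + (- real (Suc n)) * (p x * deriv g x)"
  have "smooth ?q"
    by (intro smooth_add smooth_mult smooth_deriv smooth_const h(2) assms)
  moreover have "(h has_real_derivative ?q x / g x ^ Suc (Suc n)) (at x)" for x
    unfolding h(1)
    by (rule derivative_eq_intros smooth_DERIV[OF h(2)] smooth_DERIV[OF assms(2)] refl)+
       (use nz in \<open>simp_all add: divide_simps, simp add: algebra_simps\<close>)
  ultimately show "\<exists>h'\<in>{\<lambda>x. p x / g x ^ Suc n |p n. smooth p}. \<forall>x. (h has_real_derivative h' x) (at x)"
    by (intro bexI[where x = "\<lambda>x. ?q x / g x ^ Suc (Suc n)"])
       (blast, rule CollectI, rule exI[where x = ?q], rule exI[where x = "Suc n"], simp)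
qed

section \<open>A flat function and a smooth step\<close>

definition flat_exp :: "real poly \<Rightarrow> real \<Rightarrow> real" where
  "flat_exp p x = (if x > 0 then poly p (1 / x) * exp (- (1 / x)) else 0)"

lemma poly_times_exp_tendsto_0: "((\<lambda>t. poly p t * exp (- t)) \<longlongrightarrow> (0::real)) at_top"
proof -
  have "((\<lambda>t. \<Sum>i\<le>degree p. coeff p i * (t ^ i / exp t)) \<longlongrightarrow> (\<Sum>i\<le>degree p. coeff p i * 0)) at_top"
    by (intro tendsto_intros tendsto_power_div_exp_0)
  moreover have "(\<Sum>i\<le>degree p. coeff p i * (t ^ i / exp t)) = poly p t * exp (- t)" for t
    by (simp add: poly_altdef sum_distrib_right exp_minus divide_inverse mult.assoc)
  ultimately show ?thesis
    by simp
qed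

text \<open>The polynomial parameter makes the family stable: with t = 1/x, differentiating p(t)
  exp(-t) in x multiplies by t^2 and replaces p by p - p'.\<close>

lemma flat_exp_DERIV:
  "(flat_exp p has_real_derivative flat_exp ([:0, 0, 1:] * (p - pderiv p)) x) (at x)"
proof -
  consider "x > 0" | "x < 0" | "x = 0" by linarith
  then show ?thesis
  proof cases
    case 1
    have inv: "((\<lambda>x. 1 / x) has_real_derivative - 1 / x\<^sup>2) (at x)"
      using 1 by (auto intro!: derivative_eq_intros simp: power2_eq_square)
    have poly: "((\<lambda>x. poly p (1 / x)) has_real_derivative poly (pderiv p) (1 / x) * (- 1 / x\<^sup>2)) (at x)"
      by (rule DERIV_chain2[OF poly_DERIV inv])
    have exp: "((\<lambda>x. exp (- (1 / x))) has_real_derivative exp (- (1 / x)) * (- (- 1 / x\<^sup>2))) (at x)"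
      by (rule DERIV_chain2[OF DERIV_exp DERIV_minus[OF inv]])
    have "((\<lambda>x. poly p (1 / x) * exp (- (1 / x))) has_real_derivative
        flat_exp ([:0, 0, 1:] * (p - pderiv p)) x) (at x)"
      by (rule DERIV_cong[OF DERIV_mult[OF poly exp]])
         (use 1 in \<open>simp add: flat_exp_def field_simps power2_eq_square\<close>)
    then show ?thesis
      by (rule has_field_derivative_transform_within_open[where S = "{0<..}"])
         (use 1 in \<open>auto simp: flat_exp_def\<close>)
  next
    case 2
    then have "((\<lambda>x. 0) has_real_derivative flat_exp ([:0, 0, 1:] * (p - pderiv p)) x) (at x)"
      by (simp add: flat_exp_def)
    then show ?thesis
      by (rule has_field_derivative_transform_within_open[where S = "{..<0}"])
         (use 2 in \<open>auto simp: flat_exp_def\<close>)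
  next
    case 3
    have "((\<lambda>y. flat_exp p y / y) \<longlongrightarrow> 0) (at_right 0)"
    proof -
      \<comment> \<open>The difference quotient at 0 carries an extra factor 1/y, which only changes
        the polynomial in 1/y; the exponential still wins.\<close>
      have "((\<lambda>y. poly ([:0, 1:] * p) (inverse y) * exp (- inverse y)) \<longlongrightarrow> 0) (at_right 0)"
        by (rule filterlim_compose[OF poly_times_exp_tendsto_0 filterlim_inverse_at_top_right])
      moreover have "eventually (\<lambda>y. poly ([:0, 1:] * p) (inverse y) * exp (- inverse y) = flat_exp p y / y)
          (at_right 0)"
        by (rule eventually_at_right_less[THEN eventually_mono]) (simp add: flat_exp_def field_simps)
      ultimately show ?thesis
        by (rule Lim_transform_eventually)
    qed
    moreover have "((\<lambda>y. flat_exp p y / y) \<longlongrightarrow> 0) (at_left 0)"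
      by (rule tendsto_eventually, rule eventually_at_left_real[of "-1" 0, THEN eventually_mono])
         (auto simp: flat_exp_def)
    ultimately have "((\<lambda>y. flat_exp p y / y) \<longlongrightarrow> 0) (at 0)"
      using filterlim_split_at by blast
    then show ?thesis
      using 3 by (simp add: has_field_derivative_iff flat_exp_def)
  qed
qed

lemma smooth_flat_exp: "smooth (flat_exp p)"
  by (rule smoothI_invariant[where S = "range flat_exp"]) (use flat_exp_DERIV in blast)+

definition smooth_step :: "real \<Rightarrow> real" where
  "smooth_step x = flat_exp 1 x / (flat_exp 1 x + flat_exp 1 (- 1 * x + 1))"

text \<open>x and 1 - x cannot both be nonpositive. The form \<open>- 1 * x + 1\<close> is chosen to
  match \<open>smooth_compose_affine\<close>.\<close>

lemma flat_exp_1_sum_pos: "flat_exp 1 x + flat_exp 1 (- 1 * x + 1) > 0"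
  by (auto simp: flat_exp_def add_pos_pos)

lemma smooth_smooth_step: "smooth smooth_step"
proof -
  have "smooth (\<lambda>x. flat_exp 1 x / (flat_exp 1 x + flat_exp 1 (- 1 * x + 1)))"
    using flat_exp_1_sum_pos
    by (intro smooth_divide smooth_add smooth_flat_exp smooth_compose_affine) (simp add: less_imp_neq[symmetric])
  then show ?thesis
    by (simp add: smooth_step_def[abs_def])
qed

lemma smooth_step_le_0: "x \<le> 0 \<Longrightarrow> smooth_step x = 0"
  by (simp add: smooth_step_def flat_exp_def)

lemma smooth_step_ge_1: "x \<ge> 1 \<Longrightarrow> smooth_step x = 1"
  by (simp add: smooth_step_def flat_exp_def)

lemma smooth_step_bounds: "0 \<le> smooth_step x" "smooth_step x \<le> 1"
  using flat_exp_1_sum_pos[of x] by (auto simp: smooth_step_def flat_exp_def field_simps)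

section \<open>Test functions, supports and cutoffs\<close>

lemma tsupp_subsetI: "closed S \<Longrightarrow> (\<And>x. x \<notin> S \<Longrightarrow> \<psi> x = 0) \<Longrightarrow> tsupp \<psi> \<subseteq> S"
  unfolding tsupp_def by (rule closure_minimal) blast+

lemma zero_outside_tsupp: "x \<notin> tsupp \<psi> \<Longrightarrow> \<psi> x = 0"
  using closure_subset[of "{x. \<psi> x \<noteq> 0}"] by (auto simp: tsupp_def)

lemma test_funI:
  assumes "smooth \<psi>" "compact K" "K \<subseteq> U" "\<And>x. x \<notin> K \<Longrightarrow> \<psi> x = 0"
  shows "test_fun U \<psi>"
proof -
  have "tsupp \<psi> \<subseteq> K"
    using assms by (intro tsupp_subsetI compact_imp_closed)
  moreover from this have "compact (tsupp \<psi>)"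
    using compact_Int_closed[OF assms(2), of "tsupp \<psi>"] by (simp add: tsupp_def inf.absorb2)
  ultimately show ?thesis
    using assms unfolding test_fun_def by blast
qed

lemma test_fun_smooth: "test_fun U \<psi> \<Longrightarrow> smooth \<psi>"
  by (simp add: test_fun_def)

lemma test_fun_tsupp_mono: "test_fun U \<psi> \<Longrightarrow> tsupp \<psi> \<subseteq> V \<Longrightarrow> test_fun V \<psi>"
  by (auto simp: test_fun_def)

lemma test_fun_0: "test_fun U (\<lambda>x. 0)"
  by (rule test_funI[where K = "{}"]) auto

lemma test_fun_mult:
  assumes "test_fun U \<psi>" "smooth \<xi>"
  shows "test_fun U (\<lambda>x. \<xi> x * \<psi> x)"
  using assms by (intro test_funI[where K = "tsupp \<psi>"] smooth_mult)
    (auto simp: test_fun_def zero_outside_tsupp[of _ \<psi>])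

lemma test_fun_lincomb:
  assumes "test_fun U \<psi>" "test_fun U \<xi>"
  shows "test_fun U (\<lambda>x. a * \<psi> x + b * \<xi> x)"
  using assms by (intro test_funI[where K = "tsupp \<psi> \<union> tsupp \<xi>"] smooth_add smooth_mult smooth_const)
    (auto simp: test_fun_def zero_outside_tsupp[of _ \<psi>] zero_outside_tsupp[of _ \<xi>])

lemma deriv_zero_outside_tsupp:
  assumes "x \<notin> tsupp \<psi>"
  shows "deriv \<psi> x = 0"
proof -
  have "((\<lambda>x. 0) has_real_derivative 0) (at x)"
    by simp
  then have "(\<psi> has_real_derivative 0) (at x)"
    by (rule has_field_derivative_transform_within_open[where S = "- tsupp \<psi>"])
       (use assms in \<open>auto simp: zero_outside_tsupp[of _ \<psi>], simp add: tsupp_def open_Compl\<close>)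
  then show ?thesis
    by (rule DERIV_imp_deriv)
qed

lemma test_fun_deriv: "test_fun U \<psi> \<Longrightarrow> test_fun U (deriv \<psi>)"
  by (rule test_funI[where K = "tsupp \<psi>"])
     (auto simp: test_fun_def smooth_deriv deriv_zero_outside_tsupp[of _ \<psi>])

lemma test_fun_bounded:
  assumes "test_fun U \<psi>"
  obtains B where "\<And>x. \<bar>\<psi> x\<bar> \<le> B"
proof -
  have "compact (\<psi> ` tsupp \<psi>)"
    using assms by (intro compact_continuous_image continuous_at_imp_continuous_on)
      (auto simp: test_fun_def smooth_isCont)
  then obtain B where B: "\<And>x. x \<in> tsupp \<psi> \<Longrightarrow> \<bar>\<psi> x\<bar> \<le> B"
    using compact_imp_bounded bounded_iff by (metis image_eqI real_norm_def)
  have "\<bar>\<psi> x\<bar> \<le> \<bar>B\<bar>" for x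
    using B[of x] zero_outside_tsupp[of x \<psi>] by fastforce
  then show ?thesis
    using that by blast
qed

lemma test_fun_lessThanD:
  assumes "test_fun {..<R} \<psi>"
  obtains m where "m < R" "\<And>x. x > m \<Longrightarrow> \<psi> x = 0"
proof (cases "tsupp \<psi> = {}")
  case True
  then show ?thesis
    by (intro that[of "R - 1"]) (auto simp: zero_outside_tsupp[of _ \<psi>])
next
  case False
  then obtain m where "m \<in> tsupp \<psi>" "\<And>x. x \<in> tsupp \<psi> \<Longrightarrow> x \<le> m"
    using compact_attains_sup assms unfolding test_fun_def by metis
  then show ?thesis
    using assms zero_outside_tsupp[of _ \<psi>] unfolding test_fun_def by (intro that[of m]) force+
qed

lemma test_fun_translate_mult:
  assumes "test_fun U \<eta>" "smooth \<psi>"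
  shows "test_fun U (\<lambda>y. \<eta> y * \<psi> (x + y))"
proof -
  have "smooth (\<lambda>y. \<psi> (x + y))"
    using smooth_compose_affine[OF assms(2), of 1 x] by (simp add: add.commute)
  from test_fun_mult[OF assms(1) this] show ?thesis
    by (simp add: mult.commute)
qed

text \<open>For x >= 0 the support moves to the left, so the bound \<open>R\<close> survives. This
  lets an identity proved below one fixed \<open>R\<close> be applied to the inner pairing of a
  convolution.\<close>

lemma test_fun_translate_lessThan:
  assumes "test_fun U \<eta>" "test_fun {..<R} \<psi>" "0 \<le> x"
  shows "test_fun {..<R} (\<lambda>y. \<eta> y * \<psi> (x + y))"
proof -
  obtain m where m: "m < R" "\<And>x. x > m \<Longrightarrow> \<psi> x = 0"
    using test_fun_lessThanD[OF assms(2)] by blast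
  have "tsupp (\<lambda>y. \<eta> y * \<psi> (x + y)) \<subseteq> {..m}"
    using m(2) assms(3) by (intro tsupp_subsetI) auto
  then show ?thesis
    using test_fun_translate_mult[OF assms(1) test_fun_smooth[OF assms(2)], of x] m(1)
    by (rule_tac test_fun_tsupp_mono) auto
qed

text \<open>The first clause of \<open>distribution\<close>, isolated: the cutoff argument splits a
  test function into finitely many pieces and so runs on linearity, before any continuity bound for
  the Caputo derivative is at hand.\<close>

definition linear_on_tests :: "real set \<Rightarrow> distr \<Rightarrow> bool" where
  "linear_on_tests U v \<longleftrightarrow> (\<forall>\<psi>1 \<psi>2 a b. test_fun U \<psi>1 \<longrightarrow> test_fun U \<psi>2 \<longrightarrow>
     v (\<lambda>x. a * \<psi>1 x + b * \<psi>2 x) = a * v \<psi>1 + b * v \<psi>2)"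

lemma linear_on_tests_diff:
  assumes "linear_on_tests U v" "test_fun U \<psi>" "test_fun U \<xi>"
  shows "v (\<lambda>x. \<psi> x - \<xi> x) = v \<psi> - v \<xi>"
proof -
  have "v (\<lambda>x. 1 * \<psi> x + (-1) * \<xi> x) = 1 * v \<psi> + (-1) * v \<xi>"
    using assms unfolding linear_on_tests_def by blast
  then show ?thesis
    by simp
qed

lemma linear_on_tests_0:
  assumes "linear_on_tests U v"
  shows "v (\<lambda>x. 0) = 0"
  using linear_on_tests_diff[OF assms test_fun_0 test_fun_0] by simp

text \<open>The telescoping cutoffs \<open>smooth_step (c * x - b - k)\<close> play the part of a partition of unity whose
  members are supported in intervals of length \<open>2 / c\<close>.\<close>

lemma vanishes_off_dsupp:
  assumes lin: "linear_on_tests U v" and \<psi>: "test_fun U \<psi>" and disj: "tsupp \<psi> \<inter> dsupp U v = {}"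
  shows "v \<psi> = 0"
proof -
  let ?G = "{V. open V \<and> V \<subseteq> U \<and> (\<forall>\<psi>. test_fun V \<psi> \<longrightarrow> v \<psi> = 0)}"
  have "compact (tsupp \<psi>)" "tsupp \<psi> \<subseteq> \<Union>?G"
    using \<psi> disj unfolding test_fun_def dsupp_def by blast+
  \<comment> \<open>\<open>e\<close> is a Lebesgue number of the cover by open sets on which
    \<open>v\<close> vanishes.\<close>
  then obtain e where e: "0 < e" "\<And>x. x \<in> tsupp \<psi> \<Longrightarrow> \<exists>V\<in>?G. ball x e \<subseteq> V"
    by (rule Heine_Borel_lemma) auto
  obtain M where M: "M > 0" "\<And>x. x \<in> tsupp \<psi> \<Longrightarrow> \<bar>x\<bar> \<le> M"
    using compact_imp_bounded[OF \<open>compact (tsupp \<psi>)\<close>] by (auto simp: bounded_pos)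
  \<comment> \<open>Consecutive cutoffs differ only on an interval of length 2 / c = 2 e / 3, which
    lies in the ball of radius \<open>e\<close> about any of its points.\<close>
  define c where "c = 3 / e"
  have c: "c > 0" using e(1) by (simp add: c_def)
  \<comment> \<open>The shift makes \<open>st 0\<close> equal to 1 on [-M, M], while
    \<open>st k\<close> vanishes there once k >= 2 c M + 1; the telescope leads from \<psi> to 0 in
    finitely many steps.\<close>
  define st where "st k x = smooth_step (c * x + (c * M + 1 - real k))" for k x
  define p where "p k x = st k x * \<psi> x" for k x
  have smooth_st: "smooth (st k)" for k
    unfolding st_def[abs_def] by (rule smooth_compose_affine[OF smooth_smooth_step])
  have test_p: "test_fun U (p k)" for k
    unfolding p_def[abs_def] using \<psi> smooth_st by (rule test_fun_mult)
  have step: "v (p k) = v (p (Suc k))" for k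
  proof -
    let ?q = "\<lambda>x. p k x - p (Suc k) x"
    let ?I = "{x. real k \<le> c * x + (c * M + 1) \<and> c * x + (c * M + 1) \<le> real k + 2}"
    have "closed ?I"
      by (intro closed_Collect_conj closed_Collect_le continuous_intros)
    have "st k x = st (Suc k) x" if "x \<notin> ?I" for x
      using that by (auto simp: st_def not_le smooth_step_le_0 smooth_step_ge_1)
    then have tq: "tsupp ?q \<subseteq> tsupp \<psi> \<inter> ?I"
      using \<open>closed ?I\<close> by (intro tsupp_subsetI closed_Int) (auto simp: p_def zero_outside_tsupp[of _ \<psi>], simp add: tsupp_def)
    have test_q: "test_fun U ?q"
      using test_fun_lincomb[OF test_p[of k] test_p[of "Suc k"], of 1 "-1"] by simp
    have "v ?q = 0"
    proof (cases "tsupp ?q = {}")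
      case True
      then have "?q = (\<lambda>x. 0)"
        using zero_outside_tsupp[of _ ?q] by auto
      then show ?thesis
        using linear_on_tests_0[OF lin] by simp
    next
      case False
      then obtain z where z: "z \<in> tsupp \<psi>" "z \<in> ?I"
        using tq by blast
      then obtain V where V: "V \<in> ?G" "ball z e \<subseteq> V"
        using e(2) by blast
      have "?I \<subseteq> ball z e"
      proof
        fix x assume "x \<in> ?I"
        with z(2) have "\<bar>c * x - c * z\<bar> \<le> 2"
          by auto
        then have "c * \<bar>x - z\<bar> \<le> 2"
          using c by (simp add: abs_mult flip: right_diff_distrib)
        then show "x \<in> ball z e"
          using e(1) by (simp add: c_def dist_real_def field_simps abs_minus_commute)
      qed
      then have "test_fun V ?q"
        using test_q tq V(2) by (intro test_fun_tsupp_mono[OF test_q]) blast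
      then show ?thesis
        using V(1) by blast
    qed
    then show ?thesis
      using linear_on_tests_diff[OF lin test_p test_p] by simp
  qed
  have "v (p 0) = v (p k)" for k
    by (induction k) (use step in auto)
  moreover have "p 0 = \<psi>"
  proof
    fix x show "p 0 x = \<psi> x"
    proof (cases "x \<in> tsupp \<psi>")
      case True
      then have "c * x + c * M \<ge> 0"
        using M(2)[OF True] c by (simp flip: distrib_left)
      then show ?thesis
        by (simp add: p_def st_def smooth_step_ge_1)
    qed (simp add: p_def zero_outside_tsupp[of _ \<psi>])
  qed
  moreover have "p (nat \<lceil>2 * c * M + 1\<rceil>) = (\<lambda>x. 0)"
  proof
    fix x show "p (nat \<lceil>2 * c * M + 1\<rceil>) x = 0"
    proof (cases "x \<in> tsupp \<psi>")
      case True
      then have "c * x \<le> c * M"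
        using M(2)[OF True] c by simp
      moreover have "real (nat \<lceil>2 * c * M + 1\<rceil>) \<ge> 2 * c * M + 1"
        by linarith
      ultimately show ?thesis
        by (simp add: p_def st_def smooth_step_le_0)
    qed (simp add: p_def zero_outside_tsupp[of _ \<psi>])
  qed
  ultimately show ?thesis
    using linear_on_tests_0[OF lin] by metis
qed

section \<open>Independence of the convolution from the cutoff\<close>

lemma gker_cong:
  assumes "\<And>x. 0 \<le> x \<Longrightarrow> F x = G x"
  shows "gker \<alpha> F = gker \<alpha> G"
proof -
  have "deriv F x = deriv G x" if "x > 0" for x
    using that assms
    by (intro deriv_cong_ev refl eventually_mono[OF eventually_nhds_in_open[of "{0<..}"]]) auto
  \<comment> \<open>Equality on x >= 0 does not determine the derivative at 0, but there the weight
    is \<open>0 powr \<alpha> = 0\<close>.\<close>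
  then have neg: "heaviside x * x powr \<alpha> * deriv F x = heaviside x * x powr \<alpha> * deriv G x" for x
    by (cases "x = 0") (auto simp: heaviside_def)
  have pos: "heaviside x * x powr (\<alpha> - 1) / Gamma \<alpha> * F x = heaviside x * x powr (\<alpha> - 1) / Gamma \<alpha> * G x" for x
    using assms by (simp add: heaviside_def)
  have zero: "F 0 = G 0"
    by (simp add: assms)
  show ?thesis
    unfolding gker_def regular_def dD_def ddirac_def
    by (cases "\<alpha> > 0"; cases "\<alpha> = 0") (simp_all only: if_True if_False simp_thms neg pos zero)
qed

text \<open>For x >= 0 two admissible cutoffs give the same inner value, because their difference
  times the translate of \<psi> is supported off \<open>dsupp\<close>; by \<open>gker_cong\<close>
  only these x count. Having \<eta> = 1 near all of [0, R], not just near the support of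
  \<open>v\<close>, frees later computations from locating that support.\<close>

lemma J_eq:
  assumes lin: "linear_on_tests (below T) v" and supp: "dsupp (below T) v \<subseteq> {0..}"
    and \<eta>: "test_fun (below T) \<eta>" and V: "open V" "{0..R} \<subseteq> V" "\<And>x. x \<in> V \<Longrightarrow> \<eta> x = 1"
    and R: "ereal R < T" and \<psi>: "test_fun {..<R} \<psi>"
  shows "J T \<alpha> v \<psi> = gker \<alpha> (\<lambda>x. v (\<lambda>y. \<eta> y * \<psi> (x + y)))"
proof -
  have "dsupp (below T) v \<inter> {..R} \<subseteq> {0..R}"
    using supp by auto
  then have "dsupp (below T) v \<inter> {..R} \<subseteq> V"
    using V(2) by (rule subset_trans)
  then have cut: "cutoff T v R \<eta>"
    unfolding cutoff_def using \<eta> V by blast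
  have "gker \<alpha> (\<lambda>x. v (\<lambda>y. \<eta> y * \<psi> (x + y))) = gker \<alpha> (\<lambda>x. v (\<lambda>y. \<eta>' y * \<psi> (x + y)))"
    if *: "ereal R' < T" "test_fun {..<R'} \<psi>" "cutoff T v R' \<eta>'" for R' \<eta>'
  proof (rule gker_cong)
    fix x :: real assume x: "0 \<le> x"
    from * obtain W where W: "open W" "dsupp (below T) v \<inter> {..R'} \<subseteq> W" "\<And>x. x \<in> W \<Longrightarrow> \<eta>' x = 1"
      and \<eta>': "test_fun (below T) \<eta>'"
      unfolding cutoff_def by blast
    obtain m where m: "m < R" "\<And>x. x > m \<Longrightarrow> \<psi> x = 0"
      using test_fun_lessThanD[OF \<psi>] by blast
    obtain m' where m': "m' < R'" "\<And>x. x > m' \<Longrightarrow> \<psi> x = 0"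
      using test_fun_lessThanD[OF *(2)] by blast
    let ?a = "\<lambda>y. \<eta> y * \<psi> (x + y)" and ?b = "\<lambda>y. \<eta>' y * \<psi> (x + y)"
    \<comment> \<open>A closed set carrying the difference: above \<open>m\<close> or
      \<open>m'\<close> the translate vanishes, and on \<open>V \<inter> W\<close> both cutoffs are
      1. Support points of \<open>v\<close> up to m < R and m' < R' lie in both \<open>V\<close> and
      \<open>W\<close>, so the set misses the support.\<close>
    let ?S = "{z. z \<le> m \<and> z \<le> m'} - V \<inter> W"
    have "closed ?S"
      using V W by (intro closed_Diff closed_Collect_conj closed_Collect_le continuous_intros) auto
    have "?a y - ?b y = 0" if "y \<notin> ?S" for y
    proof -
      from that consider "y > m" | "y > m'" | "y \<in> V \<inter> W"
        by fastforce
      then show ?thesis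
      proof cases
        case 1
        then show ?thesis
          using x m(2)[of "x + y"] by simp
      next
        case 2
        then show ?thesis
          using x m'(2)[of "x + y"] by simp
      next
        case 3
        then show ?thesis
          using V(3)[of y] W(3)[of y] by simp
      qed
    qed
    with \<open>closed ?S\<close> have "tsupp (\<lambda>y. ?a y - ?b y) \<subseteq> ?S"
      by (rule tsupp_subsetI)
    moreover have "?S \<inter> dsupp (below T) v = {}"
    proof -
      have "z \<in> V \<inter> W" if "z \<in> dsupp (below T) v" "z \<le> m" "z \<le> m'" for z
      proof -
        have "z \<in> {0..R}"
          using that supp m(1) by auto
        moreover have "z \<in> dsupp (below T) v \<inter> {..R'}"
          using that m'(1) by simp
        ultimately show ?thesis
          using V(2) W(2) by blast
      qed
      then show ?thesis
        by blast
    qed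
    moreover have ta: "test_fun (below T) ?a" and tb: "test_fun (below T) ?b"
      using \<eta> \<eta>' \<psi> by (auto intro: test_fun_translate_mult test_fun_smooth)
    then have "test_fun (below T) (\<lambda>y. ?a y - ?b y)"
      using test_fun_lincomb[OF ta tb, of 1 "-1"] by simp
    ultimately have "v (\<lambda>y. ?a y - ?b y) = 0"
      by (intro vanishes_off_dsupp[OF lin]) auto
    then show "v ?a = v ?b"
      using linear_on_tests_diff[OF lin ta tb] by simp
  qed
  note eq = this
  show ?thesis
    unfolding J_def dconv_def dmult_def
  proof (rule the_equality)
    fix c
    assume "\<forall>R \<eta>. ereal R < T \<and> test_fun {..<R} \<psi> \<and> cutoff T v R \<eta> \<longrightarrow>
      c = gker \<alpha> (\<lambda>x. v (\<lambda>y. \<eta> y * \<psi> (x + y)))"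
    then show "c = gker \<alpha> (\<lambda>x. v (\<lambda>y. \<eta> y * \<psi> (x + y)))"
      using cut R \<psi> by blast
  qed (use eq in blast)
qed

lemma exists_cutoff:
  assumes "ereal R < T"
  obtains \<eta> V where "test_fun (below T) \<eta>" "open V" "{0..R} \<subseteq> V" "\<And>x. x \<in> V \<Longrightarrow> \<eta> x = 1"
proof -
  obtain R' where R': "R < R'" "ereal R' < T"
    using ereal_dense2[OF assms] by auto
  \<comment> \<open>The right ramp has length 1 / c, half the gap between R and R': the cutoff is 1
    up to the midpoint and 0 from R' on. The left ramp runs over [-2, -1].\<close>
  define c where "c = 2 / (R' - R)"
  have c: "c > 0"
    using R' by (simp add: c_def)
  let ?\<eta> = "\<lambda>x. smooth_step (1 * x + 2) * smooth_step (- c * x + c * R')"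
  show thesis
  proof (rule that[of ?\<eta> "{-1<..<R' - 1 / c}"])
    show "test_fun (below T) ?\<eta>"
    proof (rule test_funI[where K = "{-2..R'}"])
      show "smooth ?\<eta>"
        by (intro smooth_mult smooth_compose_affine smooth_smooth_step)
      show "{-2..R'} \<subseteq> below T"
      proof
        fix x assume "x \<in> {-2..R'}"
        then have "ereal x \<le> ereal R'"
          by simp
        also note R'(2)
        finally show "x \<in> below T"
          by (simp add: below_def)
      qed
      fix x :: real assume "x \<notin> {-2..R'}"
      then have "1 * x + 2 \<le> 0 \<or> - c * x + c * R' \<le> 0"
        using c mult_left_mono[of R' x c] by fastforce
      then show "?\<eta> x = 0"
        by (auto simp: smooth_step_le_0)
    qed simp
    show "{0..R} \<subseteq> {-1<..<R' - 1 / c}"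
    proof -
      have "1 / c = (R' - R) / 2"
        by (simp add: c_def)
      then show ?thesis
        using R'(1) by auto
    qed
    show "?\<eta> x = 1" if "x \<in> {-1<..<R' - 1 / c}" for x
    proof -
      have "c * x \<le> c * (R' - 1 / c)"
        using that c by simp
      then have "- c * x + c * R' \<ge> 1"
        using c by (simp add: right_diff_distrib)
      moreover have "1 * x + 2 \<ge> 1"
        using that by simp
      ultimately show ?thesis
        by (simp only: smooth_step_ge_1)
    qed
  qed simp
qed

lemma compact_below:
  assumes "compact K" "K \<subseteq> below T" "0 < T"
  obtains R where "0 < R" "ereal R < T" "K \<subseteq> {..<R}"
proof -
  obtain m where m: "ereal m < T" "\<And>x. x \<in> K \<Longrightarrow> x \<le> m"
  proof (cases "K = {}")
    case True
    then show ?thesis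
      using that[of 0] assms by (simp add: zero_ereal_def)
  next
    case False
    then obtain m where "m \<in> K" "\<And>x. x \<in> K \<Longrightarrow> x \<le> m"
      using compact_attains_sup assms by metis
    then show ?thesis
      using assms(2) by (intro that[of m]) (auto simp: below_def)
  qed
  have "ereal (max m 0) < T"
    using m(1) assms(3) by (simp add: max_def zero_ereal_def)
  then obtain R where R: "ereal (max m 0) < ereal R" "ereal R < T"
    using ereal_dense2 by blast
  show ?thesis
  proof (rule that[of R])
    show "K \<subseteq> {..<R}"
      using m(2) R(1) by force
  qed (use R in auto)
qed

section \<open>Translation integrals and the truncated kernel\<close>

lemma integrable_mult_bounded:
  fixes u p :: "'a \<Rightarrow> real"
  assumes u: "integrable M u" and p: "p \<in> borel_measurable M" "\<And>x. \<bar>p x\<bar> \<le> B"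
  shows "integrable M (\<lambda>x. u x * p x)"
proof (rule Bochner_Integration.integrable_bound)
  show "integrable M (\<lambda>x. B * u x)"
    using u by simp
  show "(\<lambda>x. u x * p x) \<in> borel_measurable M"
    using u p(1) by measurable
  have "\<bar>u x\<bar> * \<bar>p x\<bar> \<le> \<bar>u x\<bar> * \<bar>B\<bar>" for x
    by (rule mult_left_mono) (use p(2)[of x] in linarith)+
  then show "AE x in M. norm (u x * p x) \<le> norm (B * u x)"
    by (simp add: abs_mult mult.commute)
qed

lemma integrable_lborel_prod:
  fixes k u :: "real \<Rightarrow> real"
  assumes k: "integrable lborel k" and u: "integrable lborel u"
  shows "integrable (lborel \<Otimes>\<^sub>M lborel) (\<lambda>(x, y). k x * u y)"
proof (rule lborel_pair.Fubini_integrable)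
  have [measurable]: "k \<in> borel_measurable borel" "u \<in> borel_measurable borel"
    using k u by simp_all
  show "(\<lambda>(x, y). k x * u y) \<in> borel_measurable (lborel \<Otimes>\<^sub>M lborel)"
    by measurable
  show "integrable lborel (\<lambda>x. LINT y|lborel. norm (case (x, y) of (x, y) \<Rightarrow> k x * u y))"
    using k by (simp add: abs_mult)
  show "AE x in lborel. integrable lborel (\<lambda>y. case (x, y) of (x, y) \<Rightarrow> k x * u y)"
    using u by simp
qed

lemma integrable_lborel_conv:
  fixes k u :: "real \<Rightarrow> real"
  assumes k: "integrable lborel k" and u: "integrable lborel u"
  shows "integrable (lborel \<Otimes>\<^sub>M lborel) (\<lambda>(x, z). k x * u (z - x))"
proof (rule lborel_pair.Fubini_integrable)
  have [measurable]: "k \<in> borel_measurable borel" "u \<in> borel_measurable borel"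
    using k u by simp_all
  show "(\<lambda>(x, z). k x * u (z - x)) \<in> borel_measurable (lborel \<Otimes>\<^sub>M lborel)"
    by measurable
  have "(LINT z|lborel. \<bar>u (z - x)\<bar>) = (LINT z|lborel. \<bar>u z\<bar>)" for x
    using lborel_integral_real_affine[of 1 "\<lambda>z. \<bar>u z\<bar>" "-x"] by simp
  then show "integrable lborel (\<lambda>x. LINT z|lborel. norm (case (x, z) of (x, z) \<Rightarrow> k x * u (z - x)))"
    using k by (simp add: abs_mult)
  have "integrable lborel (\<lambda>z. u (z - x))" for x
    using lborel_integrable_real_affine[OF u, of 1 "-x"] by simp
  then show "AE x in lborel. integrable lborel (\<lambda>z. case (x, z) of (x, z) \<Rightarrow> k x * u (z - x))"
    by simp
qed

lemma lborel_integral_translate: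
  fixes u p :: "real \<Rightarrow> real"
  shows "(LINT y|lborel. u y * p (x + y)) = (LINT z|lborel. u (z - x) * p z)"
  using lborel_integral_real_affine[of 1 "\<lambda>y. u y * p (x + y)" "-x"] by simp

lemma fubini_translate:
  fixes k u p :: "real \<Rightarrow> real"
  assumes k: "integrable lborel k" and u: "integrable lborel u"
    and p: "p \<in> borel_measurable borel" "\<And>x. \<bar>p x\<bar> \<le> B"
  shows "(LINT x|lborel. k x * (LINT y|lborel. u y * p (x + y))) =
    (LINT y|lborel. u y * (LINT x|lborel. k x * p (x + y)))"
proof -
  note [measurable] = p(1)
  have "integrable (lborel \<Otimes>\<^sub>M lborel) (\<lambda>q. (\<lambda>(x, y). k x * u y) q * p (fst q + snd q))"
    using p(2) by (intro integrable_mult_bounded[where B = B] integrable_lborel_prod k u) auto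
  then have "integrable (lborel \<Otimes>\<^sub>M lborel) (case_prod (\<lambda>x y. k x * u y * p (x + y)))"
    by (simp add: case_prod_beta')
  from lborel_pair.Fubini_integral[OF this]
  have "(LINT x|lborel. LINT y|lborel. k x * (u y * p (x + y))) =
    (LINT y|lborel. LINT x|lborel. u y * (k x * p (x + y)))"
    by (simp add: ac_simps)
  then show ?thesis
    by simp
qed

text \<open>Substituting z = x + y before exchanging the integrals turns two successive translations
  into a pairing with one function, the convolution; this is how densities are recognised.\<close>

lemma integral_translate_eq_conv:
  fixes k u p :: "real \<Rightarrow> real"
  assumes k: "integrable lborel k" and u: "integrable lborel u"
    and p: "p \<in> borel_measurable borel" "\<And>x. \<bar>p x\<bar> \<le> B"
  shows "(LINT x|lborel. k x * (LINT y|lborel. u y * p (x + y))) =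
    (LINT z|lborel. (LINT x|lborel. k x * u (z - x)) * p z)"
proof -
  note [measurable] = p(1)
  have "integrable (lborel \<Otimes>\<^sub>M lborel) (\<lambda>q. (\<lambda>(x, z). k x * u (z - x)) q * p (snd q))"
    using p(2) by (intro integrable_mult_bounded[where B = B] integrable_lborel_conv k u) auto
  then have "integrable (lborel \<Otimes>\<^sub>M lborel) (case_prod (\<lambda>x z. k x * u (z - x) * p z))"
    by (simp add: case_prod_beta')
  from lborel_pair.Fubini_integral[OF this]
  have "(LINT x|lborel. LINT z|lborel. k x * (u (z - x) * p z)) =
    (LINT z|lborel. LINT x|lborel. k x * u (z - x) * p z)"
    by (simp add: ac_simps)
  then show ?thesis
    by (simp add: lborel_integral_translate)
qed

text \<open>Cutting the kernel at \<open>R\<close> makes it integrable on the whole line, so that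
  Fubini applies; functions vanishing from \<open>R\<close> on do not see the cut.\<close>

definition trunc_ker :: "real \<Rightarrow> real \<Rightarrow> real \<Rightarrow> real" where
  "trunc_ker R \<alpha> x = indicator {0<..<R} x * (x powr (\<alpha> - 1) / Gamma \<alpha>)"

text \<open>Carries the known gauge integrals of the power and of the Beta integrand, singular at
  endpoints, over to Lebesgue integrals: nonnegativity turns gauge integrability into absolute
  integrability.\<close>

lemma nonneg_has_integral_lborel:
  fixes f :: "real \<Rightarrow> real"
  assumes f: "(f has_integral I) S" and [measurable]: "f \<in> borel_measurable borel" "S \<in> sets borel"
    and nonneg: "\<And>x. x \<in> S \<Longrightarrow> 0 \<le> f x"
  shows "has_bochner_integral lborel (\<lambda>x. indicator S x * f x) I"
proof -
  have "f absolutely_integrable_on S"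
    using f nonneg by (intro nonnegative_absolutely_integrable_1) auto
  then have int: "integrable lborel (\<lambda>x. indicator S x * f x)"
    by (simp add: set_integrable_def integrable_completion)
  then have "((\<lambda>x. indicator S x * f x) has_integral (LINT x|lborel. indicator S x * f x)) UNIV"
    by (rule has_integral_integral_lborel)
  moreover have "(\<lambda>x. indicator S x * f x) = (\<lambda>x. if x \<in> S then f x else 0)"
    by auto
  then have "((\<lambda>x. indicator S x * f x) has_integral I) UNIV"
    using f by (simp add: has_integral_restrict_UNIV)
  ultimately show ?thesis
    using int has_integral_unique by (metis has_bochner_integral_iff)
qed

lemma integrable_trunc_ker:
  assumes "0 < \<alpha>" "0 < R"
  shows "integrable lborel (trunc_ker R \<alpha>)"
proof (rule Bochner_Integration.integrable_bound)
  have "((\<lambda>x. x powr (\<alpha> - 1)) has_integral R powr (\<alpha> - 1 + 1) / (\<alpha> - 1 + 1)) {0..R}"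
    using assms by (intro has_integral_powr_from_0) auto
  then have "has_bochner_integral lborel (\<lambda>x. indicator {0..R} x * x powr (\<alpha> - 1))
      (R powr (\<alpha> - 1 + 1) / (\<alpha> - 1 + 1))"
    by (rule nonneg_has_integral_lborel) auto
  then show "integrable lborel (\<lambda>x. (indicator {0..R} x * x powr (\<alpha> - 1)) / Gamma \<alpha>)"
    by (simp add: has_bochner_integral_iff)
  show "trunc_ker R \<alpha> \<in> borel_measurable lborel"
    unfolding trunc_ker_def[abs_def] by measurable
qed (auto simp: trunc_ker_def indicator_def)

text \<open>The substitution x = z t yields the Beta integral at \<gamma>, 1 - \<gamma>; the powers
  of z cancel with the Jacobian because the exponents sum to -1, and the Gamma factors cancel
  because \<Gamma>(1) = 1. As z < R, the truncation is not felt.\<close>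

lemma trunc_ker_conv:
  assumes \<gamma>: "0 < \<gamma>" "\<gamma> < 1" and z: "0 < z" "z < R"
  shows "(LINT x|lborel. trunc_ker R \<gamma> x * trunc_ker R (1 - \<gamma>) (z - x)) = 1"
proof -
  let ?b = "\<lambda>t. t powr (\<gamma> - 1) * (1 - t) powr (1 - \<gamma> - 1)"
  have "(?b has_integral Beta \<gamma> (1 - \<gamma>)) {0..1}"
    using \<gamma> by (intro has_integral_Beta_real) auto
  then have *: "has_bochner_integral lborel (\<lambda>t. indicator {0..1} t * ?b t) (Beta \<gamma> (1 - \<gamma>))"
    by (rule nonneg_has_integral_lborel) auto
  have eq: "z * (trunc_ker R \<gamma> (z * t) * trunc_ker R (1 - \<gamma>) (z - z * t)) =
      (indicator {0..1} t * ?b t) / (Gamma \<gamma> * Gamma (1 - \<gamma>))" for t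
  proof (cases "0 < t \<and> t < 1")
    case True
    then have "0 < z * t" "z * t < z"
      using z by simp_all
    then have t: "0 < z * t" "z * t < R" "0 < z - z * t" "z - z * t < R" "z - z * t = z * (1 - t)"
      using z by (simp_all only: right_diff_distrib)
    have "z powr (\<gamma> - 1) * z powr (1 - \<gamma> - 1) = z powr (- 1)"
      by (simp flip: powr_add)
    then have one: "z * (z powr (\<gamma> - 1) * z powr (1 - \<gamma> - 1)) = 1"
      using z by (simp add: powr_minus)
    have "z * ((z * t) powr (\<gamma> - 1) * (z * (1 - t)) powr (1 - \<gamma> - 1)) =
        (z * (z powr (\<gamma> - 1) * z powr (1 - \<gamma> - 1))) * ?b t"
      using z True by (simp add: powr_mult)
    then have "z * ((z * t) powr (\<gamma> - 1) * (z - z * t) powr (1 - \<gamma> - 1)) = ?b t"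
      unfolding one t(5) by simp
    moreover have "z * (trunc_ker R \<gamma> (z * t) * trunc_ker R (1 - \<gamma>) (z - z * t)) =
        z * ((z * t) powr (\<gamma> - 1) * (z - z * t) powr (1 - \<gamma> - 1)) / (Gamma \<gamma> * Gamma (1 - \<gamma>))"
      using t(1-4) by (simp add: trunc_ker_def)
    moreover have "indicator {0..1} t = (1::real)"
      using True by simp
    ultimately show ?thesis
      by (simp only: mult_1)
  next
    case False
    \<comment> \<open>At t = 0 and t = 1 the closed indicator is 1 although the kernels are cut to
      open intervals; both sides still vanish since \<open>0 powr\<close> is 0.\<close>
    then consider "t \<le> 0" | "t \<ge> 1"
      by linarith
    then show ?thesis
    proof cases
      case 1
      then have "z * t \<le> 0"
        using z by (simp add: mult_le_0_iff)
      then show ?thesis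
        using 1 by (cases "t = 0") (auto simp: trunc_ker_def)
    next
      case 2
      then have "z - z * t \<le> 0"
        using z by simp
      then show ?thesis
        using 2 by (cases "t = 1") (auto simp: trunc_ker_def)
    qed
  qed
  have "(LINT x|lborel. trunc_ker R \<gamma> x * trunc_ker R (1 - \<gamma>) (z - x)) =
      (LINT t|lborel. z * (trunc_ker R \<gamma> (z * t) * trunc_ker R (1 - \<gamma>) (z - z * t)))"
    using z lborel_integral_real_affine[of z "\<lambda>x. trunc_ker R \<gamma> x * trunc_ker R (1 - \<gamma>) (z - x)" 0]
    by simp
  also have "\<dots> = Beta \<gamma> (1 - \<gamma>) / (Gamma \<gamma> * Gamma (1 - \<gamma>))"
    unfolding eq using * by (simp add: has_bochner_integral_iff)
  also have "\<dots> = 1"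
    using \<gamma> less_imp_neq[OF Gamma_real_pos, of \<gamma>] less_imp_neq[OF Gamma_real_pos, of "1 - \<gamma>"]
    by (simp add: Beta_def)
  finally show ?thesis .
qed

text \<open>The weak form of \<open>g\<^sub>\<gamma> * g\<^sub>1\<^sub>-\<^sub>\<gamma> =
  \<theta>\<close>. Above \<open>R\<close> truncation spoils the identity, but \<open>p\<close>
  vanishes there; for z <= 0 the arguments x and z - x are never both positive.\<close>

lemma trunc_ker_semigroup:
  fixes p :: "real \<Rightarrow> real"
  assumes \<gamma>: "0 < \<gamma>" "\<gamma> < 1" and R: "0 < R"
    and p: "p \<in> borel_measurable borel" "\<And>x. \<bar>p x\<bar> \<le> B" "\<And>x. R \<le> x \<Longrightarrow> p x = 0"
  shows "(LINT x|lborel. trunc_ker R \<gamma> x * (LINT y|lborel. trunc_ker R (1 - \<gamma>) y * p (x + y))) =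
    (LINT z|lborel. indicator {0<..<R} z * p z)"
proof -
  have eq: "(LINT x|lborel. trunc_ker R \<gamma> x * trunc_ker R (1 - \<gamma>) (z - x)) * p z = indicator {0<..<R} z * p z" for z
  proof -
    consider "R \<le> z" | "0 < z" "z < R" | "z \<le> 0"
      by linarith
    then show ?thesis
    proof cases
      case 1
      then show ?thesis
        by (simp add: p(3)[OF 1])
    next
      case 2
      then show ?thesis
        by (simp add: trunc_ker_conv[OF \<gamma> 2])
    next
      case 3
      then have "trunc_ker R \<gamma> x * trunc_ker R (1 - \<gamma>) (z - x) = 0" for x
        by (cases "0 < x") (auto simp: trunc_ker_def)
      then have "(LINT x|lborel. trunc_ker R \<gamma> x * trunc_ker R (1 - \<gamma>) (z - x)) = 0"
        by (simp only: integral_zero)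
      then show ?thesis
        using 3 by simp
    qed
  qed
  show ?thesis
    using integral_translate_eq_conv[OF integrable_trunc_ker integrable_trunc_ker p(1,2), of \<gamma> R "1 - \<gamma>" R] \<gamma> R
    unfolding eq by simp
qed

section \<open>The du Bois-Reymond lemma\<close>

text \<open>Differentiation under the integral sign: by the mean value bound,
  \<open>B * \<bar>w y\<bar>\<close> dominates the difference quotients, so integrability of
  \<open>w\<close> suffices.\<close>

lemma DERIV_integral_translate:
  assumes w: "integrable lborel w" and \<psi>: "test_fun U \<psi>"
  shows "((\<lambda>x. LINT y|lborel. w y * \<psi> (x + y)) has_real_derivative
    (LINT y|lborel. w y * deriv \<psi> (x + y))) (at x)"
proof -
  note [measurable] = smooth_measurable[OF test_fun_smooth[OF \<psi>]]
    smooth_measurable[OF smooth_deriv[OF test_fun_smooth[OF \<psi>]]]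
  have [measurable]: "w \<in> borel_measurable borel"
    using w by simp
  obtain A where A: "\<And>x. \<bar>\<psi> x\<bar> \<le> A"
    using test_fun_bounded[OF \<psi>] by blast
  obtain B where B: "\<And>x. \<bar>deriv \<psi> x\<bar> \<le> B"
    using test_fun_bounded[OF test_fun_deriv[OF \<psi>]] by blast
  have D: "(\<psi> has_real_derivative deriv \<psi> x) (at x)" for x
    using \<psi> test_fun_smooth smooth_DERIV by blast
  have int: "integrable lborel (\<lambda>y. w y * \<psi> (x + y))" for x
    using A by (intro integrable_mult_bounded[where B = A] w) auto
  show ?thesis
    unfolding has_field_derivative_iff tendsto_at_iff_sequentially comp_def
  proof (intro allI impI)
    fix X :: "nat \<Rightarrow> real"
    assume X: "\<forall>i. X i \<in> UNIV - {x}" "X \<longlonglongrightarrow> x"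
    let ?q = "\<lambda>i y. w y * ((\<psi> (X i + y) - \<psi> (x + y)) / (X i - x))"
    have "(\<lambda>i. LINT y|lborel. ?q i y) \<longlonglongrightarrow> (LINT y|lborel. w y * deriv \<psi> (x + y))"
    proof (rule integral_dominated_convergence)
      show "integrable lborel (\<lambda>y. B * \<bar>w y\<bar>)"
        using w by simp
      have "(\<lambda>i. (\<psi> (X i + y) - \<psi> (x + y)) / (X i - x)) \<longlonglongrightarrow> deriv \<psi> (x + y)" for y
      proof -
        have "((\<lambda>s. (\<psi> s - \<psi> (x + y)) / (s - (x + y))) \<longlongrightarrow> deriv \<psi> (x + y)) (at (x + y))"
          using D[of "x + y"] by (simp add: has_field_derivative_iff)
        moreover have "\<forall>i. X i + y \<in> UNIV - {x + y}" "(\<lambda>i. X i + y) \<longlonglongrightarrow> x + y"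
          using X by (auto intro: tendsto_intros)
        ultimately show ?thesis
          unfolding tendsto_at_iff_sequentially comp_def by fastforce
      qed
      then show "AE y in lborel. (\<lambda>i. ?q i y) \<longlonglongrightarrow> w y * deriv \<psi> (x + y)"
        by (intro AE_I2 tendsto_mult_left)
      fix i
      have "\<bar>?q i y\<bar> \<le> B * \<bar>w y\<bar>" for y
      proof -
        have "\<bar>\<psi> (X i + y) - \<psi> (x + y)\<bar> \<le> B * \<bar>X i + y - (x + y)\<bar>"
          using field_differentiable_bound[of UNIV \<psi> "deriv \<psi>" B "X i + y" "x + y"] D B by auto
        moreover have "0 < \<bar>X i - x\<bar>"
          using X(1) by auto
        ultimately have "\<bar>\<psi> (X i + y) - \<psi> (x + y)\<bar> / \<bar>X i - x\<bar> \<le> B"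
          by (simp add: divide_le_eq)
        then have "\<bar>w y\<bar> * (\<bar>\<psi> (X i + y) - \<psi> (x + y)\<bar> / \<bar>X i - x\<bar>) \<le> \<bar>w y\<bar> * B"
          by (rule mult_left_mono) simp
        then show ?thesis
          by (simp add: abs_mult mult.commute)
      qed
      then show "AE y in lborel. norm (?q i y) \<le> B * \<bar>w y\<bar>"
        by simp
    qed measurable
    moreover have "(LINT y|lborel. ?q i y) =
        ((LINT y|lborel. w y * \<psi> (X i + y)) - (LINT y|lborel. w y * \<psi> (x + y))) / (X i - x)" for i
      using int[of "X i"] int[of x] by (simp add: right_diff_distrib flip: Bochner_Integration.integral_diff)
    ultimately show "(\<lambda>i. ((LINT y|lborel. w y * \<psi> (X i + y)) - (LINT y|lborel. w y * \<psi> (x + y))) / (X i - x))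
        \<longlonglongrightarrow> (LINT y|lborel. w y * deriv \<psi> (x + y))"
      by (simp only:)
  qed
qed

text \<open>The identity D \<theta> = \<delta> below \<open>R\<close>: the upper boundary term
  vanishes because x + R >= R. It serves both to write the \<phi>0 term of the Caputo derivative as
  a derivative and to undo the derivative at the end.\<close>

lemma integral_deriv_translate:
  assumes \<psi>: "test_fun {..<R} \<psi>" and x: "0 \<le> x" and R: "0 < R"
  shows "(LINT z|lborel. indicator {0<..<R} z * deriv \<psi> (x + z)) = - \<psi> x"
proof -
  have sm: "smooth \<psi>"
    using \<psi> by (rule test_fun_smooth)
  note [measurable] = smooth_measurable[OF smooth_deriv[OF sm]]
  obtain m where m: "m < R" "\<And>x. x > m \<Longrightarrow> \<psi> x = 0"
    using test_fun_lessThanD[OF \<psi>] by blast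
  have D: "((\<lambda>z. \<psi> (x + z)) has_real_derivative deriv \<psi> (x + z)) (at z)" for z
    using DERIV_shift[of \<psi> "deriv \<psi> (x + z)" z x] smooth_DERIV[OF sm] by (simp add: add.commute)
  have "isCont (\<lambda>z. deriv \<psi> (x + z)) z" for z
    by (rule isCont_o2[where g = "deriv \<psi>"]) (simp_all add: smooth_isCont[OF smooth_deriv[OF sm]])
  then have "(LINT z|lborel. deriv \<psi> (x + z) * indicator {0..R} z) = \<psi> (x + R) - \<psi> (x + 0)"
    using R D by (intro integral_FTC_Icc_real) auto
  moreover have "\<psi> (x + R) = 0"
    using m x by (intro m(2)) simp
  moreover have "(LINT z|lborel. indicator {0<..<R} z * deriv \<psi> (x + z)) =
      (LINT z|lborel. deriv \<psi> (x + z) * indicator {0..R} z)"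
  proof (rule integral_cong_AE)
    have "AE z in lborel. z \<noteq> 0 \<and> z \<noteq> R"
      by (auto intro: AE_conjI AE_lborel_singleton)
    then show "AE z in lborel. indicator {0<..<R} z * deriv \<psi> (x + z) = deriv \<psi> (x + z) * indicator {0..R} z"
      by eventually_elim (auto simp: indicator_def)
  qed measurable
  ultimately show ?thesis
    by simp
qed

lemma vanishing_pairings_imp_integral_zero:
  assumes w: "integrable lborel w"
    and zero: "\<And>\<psi>. test_fun {0<..<R} \<psi> \<Longrightarrow> (LINT x|lborel. w x * \<psi> x) = 0"
    and ab: "0 \<le> a" "b \<le> R"
  shows "(LINT x|lborel. indicator {a<..<b} x * w x) = 0"
proof -
  have [measurable]: "w \<in> borel_measurable borel"
    using w by simp
  \<comment> \<open>The ramps rise on [a + 1/n, a + 2/n] and fall on [b - 2/n, b - 1/n]; the offset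
    1 keeps the support compactly inside the open interval.\<close>
  define \<psi> where "\<psi> n x = smooth_step (real n * x + (- real n * a - 1)) * smooth_step (- real n * x + (real n * b - 1))"
    for n x
  have sm: "smooth (\<psi> n)" for n
    unfolding \<psi>_def[abs_def] by (intro smooth_mult smooth_compose_affine smooth_smooth_step)
  note [measurable] = smooth_measurable[OF sm]
  have test: "test_fun {0<..<R} (\<psi> (Suc n))" for n
  proof (rule test_funI[where K = "{a + 1 / Suc n..b - 1 / Suc n}"])
    have "0 < 1 / Suc n"
      by simp
    then show "{a + 1 / Suc n..b - 1 / Suc n} \<subseteq> {0<..<R}"
      using ab by (intro subsetI, unfold atLeastAtMost_iff greaterThanLessThan_iff) linarith
    fix x :: real
    assume "x \<notin> {a + 1 / Suc n..b - 1 / Suc n}"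
    then consider "x \<le> a + 1 / Suc n" | "x \<ge> b - 1 / Suc n"
      unfolding atLeastAtMost_iff by linarith
    then show "\<psi> (Suc n) x = 0"
    proof cases
      case 1
      then have "real (Suc n) * x \<le> real (Suc n) * (a + 1 / Suc n)"
        by (intro mult_left_mono) auto
      then have "real (Suc n) * x + (- real (Suc n) * a - 1) \<le> 0"
        by (simp add: distrib_left del: of_nat_Suc)
      then show ?thesis
        unfolding \<psi>_def by (simp only: smooth_step_le_0 mult_zero_left)
    next
      case 2
      then have "real (Suc n) * x \<ge> real (Suc n) * (b - 1 / Suc n)"
        by (intro mult_left_mono) auto
      then have "- real (Suc n) * x + (real (Suc n) * b - 1) \<le> 0"
        by (simp add: right_diff_distrib del: of_nat_Suc)
      then show ?thesis
        unfolding \<psi>_def by (simp only: smooth_step_le_0 mult_zero_right)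
    qed
  qed (use sm in simp_all)
  have "(\<lambda>n. LINT x|lborel. w x * \<psi> (Suc n) x) \<longlonglongrightarrow> (LINT x|lborel. indicator {a<..<b} x * w x)"
  proof (rule integral_dominated_convergence)
    show "integrable lborel (\<lambda>x. \<bar>w x\<bar>)"
      using w by simp
    have "\<bar>\<psi> (Suc n) x\<bar> \<le> 1" for n x
      unfolding \<psi>_def abs_mult using smooth_step_bounds by (intro mult_le_one) auto
    then have "\<bar>w x\<bar> * \<bar>\<psi> (Suc n) x\<bar> \<le> \<bar>w x\<bar> * 1" for n x
      by (intro mult_left_mono) auto
    then show "AE x in lborel. norm (w x * \<psi> (Suc n) x) \<le> \<bar>w x\<bar>" for n
      by (simp add: abs_mult)
    have "(\<lambda>n. w x * \<psi> (Suc n) x) \<longlonglongrightarrow> indicator {a<..<b} x * w x" for x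
    proof (rule LIMSEQ_Suc[of "\<lambda>n. w x * \<psi> n x"], rule tendsto_eventually)
      show "eventually (\<lambda>n. w x * \<psi> n x = indicator {a<..<b} x * w x) sequentially"
      proof (cases "x \<in> {a<..<b}")
        case True
        \<comment> \<open>As soon as 2/n <= e, the point x lies on the plateau of both
          ramps.\<close>
        define e where "e = min (x - a) (b - x)"
        have e: "e > 0" "e \<le> x - a" "e \<le> b - x"
          using True by (auto simp: e_def)
        have "eventually (\<lambda>n. 2 / e \<le> real n) sequentially"
          using filterlim_real_sequentially unfolding filterlim_at_top by blast
        then show ?thesis
        proof eventually_elim
          case (elim n)
          then have "2 \<le> real n * e"
            using e(1) by (simp add: divide_le_eq)
          moreover have "real n * e \<le> real n * (x - a)" "real n * e \<le> real n * (b - x)"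
            using e by (auto intro: mult_left_mono)
          ultimately have "1 \<le> real n * x + (- real n * a - 1)" "1 \<le> - real n * x + (real n * b - 1)"
            by (simp_all add: right_diff_distrib)
          then have "\<psi> n x = 1"
            unfolding \<psi>_def by (simp only: smooth_step_ge_1 mult_1)
          then show ?case
            using True by simp
        qed
      next
        case False
        then consider "x \<le> a" | "b \<le> x"
          by fastforce
        then have "\<psi> n x = 0" for n
        proof cases
          case 1
          then have "real n * x \<le> real n * a"
            by (intro mult_left_mono) auto
          then have "real n * x + (- real n * a - 1) \<le> 0"
            by simp
          then show ?thesis
            unfolding \<psi>_def by (simp only: smooth_step_le_0 mult_zero_left)
        next
          case 2
          then have "real n * b \<le> real n * x"
            by (intro mult_left_mono) auto
          then have "- real n * x + (real n * b - 1) \<le> 0"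
            by simp
          then show ?thesis
            unfolding \<psi>_def by (simp only: smooth_step_le_0 mult_zero_right)
        qed
        then show ?thesis
          using False by simp
      qed
    qed
    then show "AE x in lborel. (\<lambda>n. w x * \<psi> (Suc n) x) \<longlonglongrightarrow> indicator {a<..<b} x * w x"
      by simp
  qed measurable
  moreover have "(\<lambda>n. LINT x|lborel. w x * \<psi> (Suc n) x) = (\<lambda>n. 0)"
    using zero[OF test] by simp
  ultimately show ?thesis
    using LIMSEQ_unique[OF tendsto_const] by metis
qed

text \<open>Integrals over open intervals vanish by approximating indicators; intervals form a
  generator of the Borel sets stable under intersection, so Dynkin's argument extends this to all
  Borel sets, and a density with vanishing integrals is zero a.e. Cutting \<open>w\<close> to (0, R)
  first allows arbitrary intervals of the line.\<close>

lemma du_Bois_Reymond: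
  assumes w: "integrable lborel w"
    and zero: "\<And>\<psi>. test_fun {0<..<R} \<psi> \<Longrightarrow> (LINT x|lborel. w x * \<psi> x) = 0"
  shows "AE x in lborel. x \<in> {0<..<R} \<longrightarrow> w x = 0"
proof -
  define w0 where "w0 x = indicator {0<..<R} x * w x" for x
  have int: "integrable lborel w0"
    unfolding w0_def[abs_def] using integrable_mult_indicator[OF _ w, of "{0<..<R}"] by simp
  have box: "(LINT x:{a<..<b}|lborel. w0 x) = 0" for a b
  proof -
    have "indicator {a<..<b} x *\<^sub>R w0 x = indicator {max a 0<..<min b R} x * w x" for x
      by (auto simp: indicator_def w0_def)
    then show ?thesis
      unfolding set_lebesgue_integral_def
      using vanishing_pairings_imp_integral_zero[OF w zero, of R "max a 0" "min b R"] by simp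
  qed
  \<comment> \<open>Passing to complements needs the integral over the whole line to vanish as
    well.\<close>
  have total: "(LINT x|lborel. w0 x) = 0"
    using vanishing_pairings_imp_integral_zero[OF w zero, of R 0 R] by (simp add: w0_def)
  have sets_eq: "sets borel = sigma_sets UNIV (range (\<lambda>(a, b). {a<..<b::real}))"
    unfolding borel_eq_box box_real by (simp add: sets_measure_of)
  have "AE x in lborel. w0 x = 0"
  proof (rule sigma_finite_measure.density_zero[OF lborel.sigma_finite_measure_axioms int])
    fix A :: "real set"
    assume "A \<in> sets lborel"
    have "Int_stable (range (\<lambda>(a, b). {a<..<b::real}))"
      by (force intro!: Int_stableI)
    moreover have "range (\<lambda>(a, b). {a<..<b::real}) \<subseteq> Pow UNIV"
      by simp
    moreover have "A \<in> sigma_sets UNIV (range (\<lambda>(a, b). {a<..<b}))"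
      using \<open>A \<in> sets lborel\<close> sets_eq by simp
    ultimately show "(LINT x:A|lborel. w0 x) = 0"
    proof (induction rule: sigma_sets_induct_disjoint)
      case (basic A)
      then show ?case
        using box by auto
    next
      case (compl A)
      then have [measurable]: "A \<in> sets borel"
        using sets_eq by simp
      have "set_integrable lborel A w0" "set_integrable lborel (UNIV - A) w0"
        unfolding set_integrable_def by (rule integrable_mult_indicator[OF _ int]; measurable)+
      then have "(LINT x:A \<union> (UNIV - A)|lborel. w0 x) = (LINT x:A|lborel. w0 x) + (LINT x:UNIV - A|lborel. w0 x)"
        by (intro set_integral_Un) auto
      moreover have "A \<union> (UNIV - A) = UNIV"
        by blast
      ultimately show ?case
        using compl total by (simp add: set_lebesgue_integral_def)
    next
      case (union A)
      then have [measurable]: "A i \<in> sets borel" for i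
        using sets_eq by auto
      have "(LINT x:(\<Union>i. A i)|lborel. w0 x) = (\<Sum>i. LINT x:A i|lborel. w0 x)"
      proof (rule lebesgue_integral_countable_add)
        show "set_integrable lborel (\<Union>i. A i) w0"
          unfolding set_integrable_def by (rule integrable_mult_indicator[OF _ int]; measurable)+
        show "A i \<inter> A j = {}" if "i \<noteq> j" for i j
          using union(1) that by (auto simp: disjoint_family_on_def)
      qed simp
      then show ?case
        using union by simp
    qed (simp add: set_lebesgue_integral_def)
  qed
  then show ?thesis
    by eventually_elim (auto simp: w0_def)
qed

section \<open>Distributions given by locally integrable functions\<close>

text \<open>\<open>g\<close> is the function on which Fubini and translation operate. Measurability
  of the truncated \<open>h\<close> is kept alongside, since Lebesgue integrals of \<open>h\<close>
  are compared with those of \<open>g\<close> up to a null set.\<close>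

definition borel_version :: "real \<Rightarrow> (real \<Rightarrow> real) \<Rightarrow> (real \<Rightarrow> real) \<Rightarrow> bool" where
  "borel_version R h g \<longleftrightarrow> (\<lambda>x. indicator {0..R} x * h x) \<in> borel_measurable lebesgue \<and>
     integrable lborel g \<and> (\<forall>x. x \<notin> {0..R} \<longrightarrow> g x = 0) \<and> (AE x in lborel. x \<in> {0..R} \<longrightarrow> g x = h x)"

lemma exists_borel_version:
  assumes "L1loc T h" "ereal R < T"
  obtains g where "borel_version R h g"
proof -
  have "{0..R} \<subseteq> {t. 0 \<le> t \<and> ereal t < T}"
    using assms(2) by (auto intro: le_less_trans[of "ereal _" "ereal R"])
  then have int: "integrable lebesgue (\<lambda>x. indicator {0..R} x * h x)"
    using assms(1) unfolding L1loc_def set_integrable_def by fastforce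
  then obtain g0 where g0: "g0 \<in> borel_measurable lborel" "AE x in lborel. indicator {0..R} x * h x = g0 x"
    using completion_ex_borel_measurable_real borel_measurable_integrable by blast
  have ae: "AE x in lborel. indicator {0..R} x * g0 x = indicator {0..R} x * h x"
    using g0(2) by eventually_elim (auto split: split_indicator)
  have [measurable]: "g0 \<in> borel_measurable borel"
    using g0(1) by simp
  have "integrable lebesgue (\<lambda>x. indicator {0..R} x * g0 x)"
    using int AE_completion[OF ae] g0(1)
    by (subst integrable_cong_AE[where g = "\<lambda>x. indicator {0..R} x * h x"]) (auto intro: measurable_completion)
  then have "integrable lborel (\<lambda>x. indicator {0..R} x * g0 x)"
    by (simp add: integrable_completion)
  moreover have "AE x in lborel. x \<in> {0..R} \<longrightarrow> indicator {0..R} x * g0 x = h x"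
    using ae by eventually_elim auto
  ultimately have "borel_version R h (\<lambda>x. indicator {0..R} x * g0 x)"
    using borel_measurable_integrable[OF int] unfolding borel_version_def by auto
  then show thesis
    by (rule that)
qed

lemma borel_version_integrable: "borel_version R h g \<Longrightarrow> integrable lborel g"
  by (simp add: borel_version_def)

lemma borel_version_outside: "borel_version R h g \<Longrightarrow> x \<notin> {0..R} \<Longrightarrow> g x = 0"
  by (simp add: borel_version_def)

lemma integrable_indicator_Ioo: "integrable lborel (indicat_real {a<..<b::real})"
  using emeasure_bounded_finite[of "{a<..<b}"] by (intro integrable_real_indicator) simp_all

text \<open>The constant is removed on the open interval over which
  \<open>integral_deriv_translate\<close> integrates, so that both terms of the Caputo derivative
  combine; the endpoints form a null set.\<close>

lemma borel_version_diff_const: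
  assumes "borel_version R h g"
  shows "borel_version R (\<lambda>x. h x - c) (\<lambda>x. g x - c * indicator {0<..<R} x)"
proof -
  have "(\<lambda>x. indicator {0..R} x * h x - c * indicator {0..R} x) \<in> borel_measurable lebesgue"
  proof (rule borel_measurable_diff)
    show "(\<lambda>x. c * indicator {0..R} x) \<in> borel_measurable lebesgue"
      by (intro borel_measurable_times borel_measurable_indicator) auto
  qed (use assms in \<open>simp add: borel_version_def\<close>)
  moreover have "integrable lborel (\<lambda>x. g x - c * indicator {0<..<R} x)"
    using assms by (intro Bochner_Integration.integrable_diff integrable_mult_right integrable_indicator_Ioo)
      (simp add: borel_version_def)
  moreover have "AE x in lborel. x \<noteq> 0 \<and> x \<noteq> R"
    by (auto intro: AE_conjI AE_lborel_singleton)
  then have "AE x in lborel. x \<in> {0..R} \<longrightarrow> g x - c * indicator {0<..<R} x = h x - c"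
    using assms[unfolded borel_version_def, THEN conjunct2, THEN conjunct2, THEN conjunct2]
    by eventually_elim (auto simp: indicator_def)
  ultimately show ?thesis
    using assms unfolding borel_version_def by (auto simp: algebra_simps)
qed

lemma ext0_eq:
  assumes g: "borel_version R h g" and p: "p \<in> borel_measurable borel" "\<And>x. x > R \<Longrightarrow> p x = 0"
  shows "ext0 h p = (LINT x|lborel. g x * p x)"
proof -
  have [measurable]: "(\<lambda>x. indicator {0..R} x * h x) \<in> borel_measurable lebesgue" "g \<in> borel_measurable borel"
      "g \<in> borel_measurable lebesgue" "p \<in> borel_measurable lebesgue"
    using g p(1) by (auto simp: borel_version_def intro: measurable_completion)
  have "heaviside x * h x * p x = (indicator {0..R} x * h x) * p x" for x
    using p(2)[of x] by (cases "x > R") (auto simp: heaviside_def)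
  then have "ext0 h p = (LINT x|lebesgue. (indicator {0..R} x * h x) * p x)"
    by (simp only: ext0_def regular_def)
  also have "\<dots> = (LINT x|lebesgue. g x * p x)"
  proof (rule integral_cong_AE)
    have "AE x in lborel. x \<in> {0..R} \<longrightarrow> g x = h x"
      using g by (simp add: borel_version_def)
    then have "AE x in lborel. (indicator {0..R} x * h x) * p x = g x * p x"
      by eventually_elim (use borel_version_outside[OF g] in \<open>auto simp: indicator_def\<close>)
    then show "AE x in lebesgue. (indicator {0..R} x * h x) * p x = g x * p x"
      by (rule AE_completion)
  qed measurable
  also have "\<dots> = (LINT x|lborel. g x * p x)"
    using p(1) borel_measurable_integrable[OF borel_version_integrable[OF g]]
    by (intro integral_completion borel_measurable_times) simp_all
  finally show ?thesis .
qed

text \<open>The cutoff disappears: \<open>g\<close> lives on [0, R], where \<eta> is 1.\<close>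

lemma ext0_cutoff:
  assumes g: "borel_version R h g" and \<eta>: "smooth \<eta>" "\<And>x. x \<in> {0..R} \<Longrightarrow> \<eta> x = 1"
    and \<psi>: "test_fun {..<R} \<psi>" and x: "0 \<le> x"
  shows "ext0 h (\<lambda>y. \<eta> y * \<psi> (x + y)) = (LINT y|lborel. g y * \<psi> (x + y))"
proof -
  note [measurable] = smooth_measurable[OF \<eta>(1)] smooth_measurable[OF test_fun_smooth[OF \<psi>]]
  obtain m where m: "m < R" "\<And>x. x > m \<Longrightarrow> \<psi> x = 0"
    using test_fun_lessThanD[OF \<psi>] by blast
  have "ext0 h (\<lambda>y. \<eta> y * \<psi> (x + y)) = (LINT y|lborel. g y * (\<eta> y * \<psi> (x + y)))"
  proof (rule ext0_eq[OF g])
    fix y assume "y > R"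
    then show "\<eta> y * \<psi> (x + y) = 0"
      using m(1) m(2)[of "x + y"] x by simp
  qed measurable
  moreover have "g y * (\<eta> y * \<psi> (x + y)) = g y * \<psi> (x + y)" for y
    using \<eta>(2)[of y] borel_version_outside[OF g, of y] by (cases "y \<in> {0..R}") simp_all
  ultimately show ?thesis
    by (simp only:)
qed

lemma lessThan_subset_below:
  assumes "ereal R \<le> T"
  shows "{..<R} \<subseteq> below T"
proof
  fix x
  assume "x \<in> {..<R}"
  then have "ereal x < ereal R"
    by simp
  also note assms
  finally show "x \<in> below T"
    by (simp add: below_def)
qed

lemma test_fun_below_lessThan:
  "ereal R < T \<Longrightarrow> test_fun {..<R} \<psi> \<Longrightarrow> test_fun (below T) \<psi>"
  using lessThan_subset_below[OF less_imp_le, of R T] unfolding test_fun_def by blast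

lemma test_fun_belowE:
  assumes "test_fun (below T) \<psi>" "0 < T"
  obtains R where "0 < R" "ereal R < T" "test_fun {..<R} \<psi>"
  using compact_below[of "tsupp \<psi>" T] assms test_fun_tsupp_mono[OF assms(1)] unfolding test_fun_def by metis

text \<open>Integral formulas are available for one R < T at a time; two test functions share such
  an \<open>R\<close> because the union of their supports is compact.\<close>

lemma linear_on_tests_below:
  assumes T: "0 < T"
    and lin: "\<And>R. 0 < R \<Longrightarrow> ereal R < T \<Longrightarrow> linear_on_tests {..<R} v"
  shows "linear_on_tests (below T) v"
  unfolding linear_on_tests_def
proof (intro allI impI)
  fix \<psi>1 \<psi>2 a b
  assume \<psi>: "test_fun (below T) \<psi>1" "test_fun (below T) \<psi>2"
  obtain R where R: "0 < R" "ereal R < T" "tsupp \<psi>1 \<union> tsupp \<psi>2 \<subseteq> {..<R}"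
    using compact_below[of "tsupp \<psi>1 \<union> tsupp \<psi>2" T] T \<psi> unfolding test_fun_def by (metis Un_least compact_Un)
  then have "test_fun {..<R} \<psi>1" "test_fun {..<R} \<psi>2"
    using \<psi> test_fun_tsupp_mono by blast+
  then show "v (\<lambda>x. a * \<psi>1 x + b * \<psi>2 x) = a * v \<psi>1 + b * v \<psi>2"
    using lin[OF R(1,2)] unfolding linear_on_tests_def by blast
qed

lemma linear_on_testsI_pairing:
  assumes w: "integrable lborel w" and v: "\<And>\<psi>. test_fun U \<psi> \<Longrightarrow> v \<psi> = (LINT x|lborel. w x * \<psi> x)"
  shows "linear_on_tests U v"
  unfolding linear_on_tests_def
proof (intro allI impI)
  fix \<psi>1 \<psi>2 a b
  assume \<psi>: "test_fun U \<psi>1" "test_fun U \<psi>2"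
  have int: "integrable lborel (\<lambda>x. w x * \<psi> x)" if \<psi>: "test_fun U \<psi>" for \<psi>
  proof -
    obtain B where "\<And>x. \<bar>\<psi> x\<bar> \<le> B"
      using test_fun_bounded[OF \<psi>] by blast
    then show ?thesis
      using smooth_measurable[OF test_fun_smooth[OF \<psi>]] by (intro integrable_mult_bounded[OF w]) auto
  qed
  have "v (\<lambda>x. a * \<psi>1 x + b * \<psi>2 x) = (LINT x|lborel. a * (w x * \<psi>1 x) + b * (w x * \<psi>2 x))"
    by (simp add: v[OF test_fun_lincomb[OF \<psi>]] algebra_simps)
  also have "\<dots> = a * v \<psi>1 + b * v \<psi>2"
    using int[OF \<psi>(1)] int[OF \<psi>(2)] by (simp add: v[OF \<psi>(1)] v[OF \<psi>(2)])
  finally show "v (\<lambda>x. a * \<psi>1 x + b * \<psi>2 x) = a * v \<psi>1 + b * v \<psi>2" .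
qed

lemma linear_on_tests_dD:
  assumes "linear_on_tests U v"
  shows "linear_on_tests U (dD v)"
  unfolding linear_on_tests_def
proof (intro allI impI)
  fix \<psi>1 \<psi>2 a b
  assume \<psi>: "test_fun U \<psi>1" "test_fun U \<psi>2"
  have "((\<lambda>x. a * \<psi>1 x + b * \<psi>2 x) has_real_derivative a * deriv \<psi>1 x + b * deriv \<psi>2 x) (at x)" for x
    by (intro DERIV_add DERIV_cmult smooth_DERIV test_fun_smooth[OF \<psi>(1)] test_fun_smooth[OF \<psi>(2)])
  then have "deriv (\<lambda>x. a * \<psi>1 x + b * \<psi>2 x) = (\<lambda>x. a * deriv \<psi>1 x + b * deriv \<psi>2 x)"
    using DERIV_imp_deriv by blast
  moreover have "v (\<lambda>x. a * deriv \<psi>1 x + b * deriv \<psi>2 x) = a * v (deriv \<psi>1) + b * v (deriv \<psi>2)"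
    using assms \<psi>[THEN test_fun_deriv] unfolding linear_on_tests_def by blast
  ultimately show "dD v (\<lambda>x. a * \<psi>1 x + b * \<psi>2 x) = a * dD v \<psi>1 + b * dD v \<psi>2"
    by (simp add: dD_def)
qed

lemma dsupp_nonneg:
  assumes T: "0 < T" and v: "\<And>\<psi>. test_fun {..<0} \<psi> \<Longrightarrow> v \<psi> = 0"
  shows "dsupp (below T) v \<subseteq> {0..}"
proof -
  have "{..<0} \<subseteq> below T"
    using T by (intro lessThan_subset_below) (simp add: zero_ereal_def)
  then have "{..<0} \<in> {V. open V \<and> V \<subseteq> below T \<and> (\<forall>\<psi>. test_fun V \<psi> \<longrightarrow> v \<psi> = 0)}"
    by (intro CollectI conjI allI impI open_lessThan v)
  then have "dsupp (below T) v \<subseteq> - {..<0}"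
    unfolding dsupp_def by blast
  then show ?thesis
    by (simp add: Compl_lessThan)
qed

lemma zero_on_nonneg:
  assumes "test_fun {..<0} \<psi>" "0 \<le> x"
  shows "\<psi> x = 0" "deriv \<psi> x = 0"
proof -
  have "x \<notin> tsupp \<psi>"
    using assms unfolding test_fun_def by force
  then show "\<psi> x = 0" "deriv \<psi> x = 0"
    by (rule zero_outside_tsupp, rule deriv_zero_outside_tsupp)
qed

lemma dsupp_ext0:
  assumes T: "0 < T"
  shows "dsupp (below T) (ext0 h) \<subseteq> {0..}"
proof (rule dsupp_nonneg[OF T])
  fix \<psi> :: "real \<Rightarrow> real"
  assume "test_fun {..<0} \<psi>"
  then have "heaviside x * h x * \<psi> x = 0" for x
    using zero_on_nonneg(1)[of \<psi> x] by (cases "0 \<le> x") (auto simp: heaviside_def)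
  then show "ext0 h \<psi> = 0"
    by (simp only: ext0_def regular_def integral_zero)
qed

lemma linear_on_tests_ext0:
  assumes T: "0 < T" and h: "L1loc T h"
  shows "linear_on_tests (below T) (ext0 h)"
proof (rule linear_on_tests_below[OF T])
  fix R :: real
  assume "0 < R" and R: "ereal R < T"
  obtain g where g: "borel_version R h g"
    using exists_borel_version[OF h R] .
  show "linear_on_tests {..<R} (ext0 h)"
  proof (rule linear_on_testsI_pairing[OF borel_version_integrable[OF g]])
    fix \<psi>
    assume \<psi>: "test_fun {..<R} \<psi>"
    then obtain m where "m < R" "\<And>x. x > m \<Longrightarrow> \<psi> x = 0"
      using test_fun_lessThanD by blast
    then show "ext0 h \<psi> = (LINT x|lborel. g x * \<psi> x)"
      using smooth_measurable[OF test_fun_smooth[OF \<psi>]] by (intro ext0_eq[OF g]) auto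
  qed
qed

section \<open>Kernels and convolutions as Lebesgue integrals\<close>

lemma gker_eq_trunc_ker:
  assumes \<alpha>: "0 < \<alpha>" and F: "F \<in> borel_measurable borel" "\<And>x. R \<le> x \<Longrightarrow> F x = 0"
  shows "gker \<alpha> F = (LINT x|lborel. trunc_ker R \<alpha> x * F x)"
proof -
  note [measurable] = F(1)
  have "heaviside x * x powr (\<alpha> - 1) / Gamma \<alpha> * F x = trunc_ker R \<alpha> x * F x" for x
  proof -
    consider "x < 0" | "x = 0" | "0 < x" "x < R" | "R \<le> x"
      by linarith
    then show ?thesis
      by cases (use F(2)[of x] in \<open>auto simp: heaviside_def trunc_ker_def\<close>)
  qed
  then have "gker \<alpha> F = (LINT x|lebesgue. trunc_ker R \<alpha> x * F x)"
    using \<alpha> by (simp only: gker_def regular_def if_True)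
  also have "\<dots> = (LINT x|lborel. trunc_ker R \<alpha> x * F x)"
    unfolding trunc_ker_def by (intro integral_completion) measurable
  finally show ?thesis .
qed

text \<open>The exponent (1 - \<gamma>) - 1 is -\<gamma> and both normalisations are \<Gamma>(1 -
  \<gamma>), so the singular kernel is the derivative of a locally integrable one.\<close>

lemma gker_neg_eq:
  assumes "0 < \<gamma>" "\<gamma> < 1"
  shows "gker (- \<gamma>) F = - gker (1 - \<gamma>) (deriv F)"
proof -
  have "gker (1 - \<gamma>) (deriv F) = (LINT x|lebesgue. (1 / Gamma (1 - \<gamma>)) * (heaviside x * x powr (- \<gamma>) * deriv F x))"
    using assms by (simp add: gker_def regular_def mult_ac)
  also have "\<dots> = (1 / Gamma (1 - \<gamma>)) * (LINT x|lebesgue. heaviside x * x powr (- \<gamma>) * deriv F x)"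
    by (rule integral_mult_right_zero)
  finally show ?thesis
    using assms by (simp add: gker_def regular_def dD_def)
qed

lemma measurable_integral_translate [measurable]:
  fixes u p :: "real \<Rightarrow> real"
  assumes [measurable]: "u \<in> borel_measurable borel" "p \<in> borel_measurable borel"
  shows "(\<lambda>x. LINT y|lborel. u y * p (x + y)) \<in> borel_measurable borel"
  by measurable

lemma integral_translate_bounded:
  fixes u p :: "real \<Rightarrow> real"
  assumes u: "integrable lborel u" and p: "p \<in> borel_measurable borel" "\<And>x. \<bar>p x\<bar> \<le> B"
  shows "\<bar>LINT y|lborel. u y * p (x + y)\<bar> \<le> (LINT y|lborel. \<bar>u y\<bar> * B)"
proof -
  note [measurable] = p(1)
  have "\<bar>LINT y|lborel. u y * p (x + y)\<bar> \<le> (LINT y|lborel. \<bar>u y * p (x + y)\<bar>)"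
    by (rule integral_abs_bound)
  also have "\<dots> \<le> (LINT y|lborel. \<bar>u y\<bar> * B)"
  proof (rule integral_mono)
    show "integrable lborel (\<lambda>y. \<bar>u y * p (x + y)\<bar>)"
      using p(2) by (intro integrable_abs integrable_mult_bounded[OF u]) auto
    show "integrable lborel (\<lambda>y. \<bar>u y\<bar> * B)"
      using u by simp
    show "\<bar>u y * p (x + y)\<bar> \<le> \<bar>u y\<bar> * B" for y
      unfolding abs_mult by (rule mult_left_mono) (use p(2) in auto)
  qed
  finally show ?thesis .
qed

text \<open>The a.e. half later shows that the integrand of the fractional integral is genuinely
  integrable.\<close>

lemma integrable_conv:
  fixes k u :: "real \<Rightarrow> real"
  assumes "integrable lborel k" "integrable lborel u"
  shows "integrable lborel (\<lambda>z. LINT x|lborel. k x * u (z - x))"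
    and "AE z in lborel. integrable lborel (\<lambda>x. k x * u (z - x))"
  using lborel_pair.integrable_snd[OF integrable_lborel_conv[OF assms]]
    lborel_pair.AE_integrable_snd[OF integrable_lborel_conv[OF assms]] by simp_all

section \<open>The generalized Caputo derivative\<close>

lemma J_ext0:
  assumes T: "0 < T" and h: "L1loc T h" and R: "ereal R < T" and g: "borel_version R h g"
    and \<psi>: "test_fun {..<R} \<psi>"
  shows "J T \<alpha> (ext0 h) \<psi> = gker \<alpha> (\<lambda>x. LINT y|lborel. g y * \<psi> (x + y))"
proof -
  obtain \<eta> V where \<eta>: "test_fun (below T) \<eta>" "open V" "{0..R} \<subseteq> V" "\<And>x. x \<in> V \<Longrightarrow> \<eta> x = 1"
    using exists_cutoff[OF R] by blast
  have "J T \<alpha> (ext0 h) \<psi> = gker \<alpha> (\<lambda>x. ext0 h (\<lambda>y. \<eta> y * \<psi> (x + y)))"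
    by (rule J_eq[OF linear_on_tests_ext0[OF T h] dsupp_ext0[OF T] \<eta> R \<psi>])
  also have "\<dots> = gker \<alpha> (\<lambda>x. LINT y|lborel. g y * \<psi> (x + y))"
    using \<eta>(3,4) by (intro gker_cong ext0_cutoff[OF g test_fun_smooth[OF \<eta>(1)] _ \<psi>]) auto
  finally show ?thesis .
qed

lemma integral_translate_eq_0:
  fixes u p :: "real \<Rightarrow> real"
  assumes u: "\<And>y. y < 0 \<Longrightarrow> u y = 0" and p: "\<And>x. R \<le> x \<Longrightarrow> p x = 0" and x: "R \<le> x"
  shows "(LINT y|lborel. u y * p (x + y)) = 0"
proof -
  have "u y * p (x + y) = 0" for y
  proof (cases "y < 0")
    case False
    then have "R \<le> x + y"
      using x by linarith
    then show ?thesis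
      by (simp add: p)
  qed (simp add: u)
  then show ?thesis
    by (simp only: integral_zero)
qed

text \<open>The derivative in the kernel falls on \<psi> by \<open>gker_neg_eq\<close> and
  differentiation under the integral, and the \<phi>0 term takes the same shape by
  \<open>integral_deriv_translate\<close>. This is f = D
  (\<open>g\<^sub>1\<^sub>-\<^sub>\<gamma>\<close> * (\<phi> - \<phi>0)) tested below
  \<open>R\<close>, the convolution being left as an iterated integral.\<close>

lemma gen_caputo_eq:
  assumes T: "0 < T" and \<gamma>: "0 < \<gamma>" "\<gamma> < 1" and \<phi>: "L1loc T \<phi>"
    and R: "0 < R" "ereal R < T" and g: "borel_version R \<phi> g" and \<psi>: "test_fun {..<R} \<psi>"
  shows "gen_caputo T \<gamma> \<phi> \<phi>0 \<psi> = - (LINT x|lborel. trunc_ker R (1 - \<gamma>) x *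
    (LINT y|lborel. (g y - \<phi>0 * indicator {0<..<R} y) * deriv \<psi> (x + y)))"
proof -
  let ?k = "trunc_ker R (1 - \<gamma>)" and ?i = "indicat_real {0<..<R}"
  let ?A = "\<lambda>x. LINT y|lborel. g y * deriv \<psi> (x + y)"
  let ?B = "\<lambda>x. LINT y|lborel. ?i y * deriv \<psi> (x + y)"
  have k: "integrable lborel ?k" and i: "integrable lborel ?i" and g_int: "integrable lborel g"
    using \<gamma> R(1) integrable_trunc_ker[of "1 - \<gamma>" R] integrable_indicator_Ioo borel_version_integrable[OF g] by auto
  have \<psi>': "test_fun {..<R} (deriv \<psi>)"
    using \<psi> by (rule test_fun_deriv)
  have d [measurable]: "deriv \<psi> \<in> borel_measurable borel"
    by (rule smooth_measurable[OF test_fun_smooth[OF \<psi>']])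
  have [measurable]: "\<psi> \<in> borel_measurable borel" "g \<in> borel_measurable borel"
    using smooth_measurable[OF test_fun_smooth[OF \<psi>]] g_int by auto
  obtain B where B: "\<And>x. \<bar>deriv \<psi> x\<bar> \<le> B"
    using test_fun_bounded[OF \<psi>'] by blast
  have zero: "\<psi> x = 0" "deriv \<psi> x = 0" if "R \<le> x" for x
    using zero_outside_tsupp[of x \<psi>] deriv_zero_outside_tsupp[of x \<psi>] \<psi> that unfolding test_fun_def by force+
  have int: "integrable lborel (\<lambda>x. ?k x * (LINT y|lborel. u y * deriv \<psi> (x + y)))" if u: "integrable lborel u" for u
  proof -
    have "u \<in> borel_measurable borel"
      using u by simp
    then show ?thesis
      using measurable_integral_translate[OF _ d]
      by (intro integrable_mult_bounded[OF k _ integral_translate_bounded[OF u d B]]) simp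
  qed
  have "J T (- \<gamma>) (ext0 \<phi>) \<psi> = - gker (1 - \<gamma>) (deriv (\<lambda>x. LINT y|lborel. g y * \<psi> (x + y)))"
    unfolding J_ext0[OF T \<phi> R(2) g \<psi>] by (rule gker_neg_eq[OF \<gamma>])
  also have "deriv (\<lambda>x. LINT y|lborel. g y * \<psi> (x + y)) = ?A"
    using DERIV_imp_deriv[OF DERIV_integral_translate[OF g_int \<psi>]] by blast
  also have "gker (1 - \<gamma>) ?A = (LINT x|lborel. ?k x * ?A x)"
    using \<gamma> zero(2) borel_version_outside[OF g]
    by (intro gker_eq_trunc_ker integral_translate_eq_0[where R = R]) auto
  finally have 1: "J T (- \<gamma>) (ext0 \<phi>) \<psi> = - (LINT x|lborel. ?k x * ?A x)" .
  have "gker (1 - \<gamma>) \<psi> = (LINT x|lborel. ?k x * \<psi> x)"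
    using \<gamma> zero(1) by (intro gker_eq_trunc_ker) auto
  also have "\<dots> = (LINT x|lborel. - (?k x * ?B x))"
  proof (rule Bochner_Integration.integral_cong)
    fix x
    show "?k x * \<psi> x = - (?k x * ?B x)"
      using integral_deriv_translate[OF \<psi> _ R(1), of x] by (cases "0 \<le> x") (auto simp: trunc_ker_def)
  qed simp
  finally have 2: "gker (1 - \<gamma>) \<psi> = - (LINT x|lborel. ?k x * ?B x)"
    by simp
  have "(LINT y|lborel. (g y - \<phi>0 * ?i y) * deriv \<psi> (x + y)) = ?A x - \<phi>0 * ?B x" for x
  proof -
    have "integrable lborel (\<lambda>y. g y * deriv \<psi> (x + y))" "integrable lborel (\<lambda>y. ?i y * deriv \<psi> (x + y))"
      using B by (intro integrable_mult_bounded[where B = B] g_int i; simp)+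
    then show ?thesis
      by (simp add: left_diff_distrib mult.assoc)
  qed
  then have "(LINT x|lborel. ?k x * (LINT y|lborel. (g y - \<phi>0 * ?i y) * deriv \<psi> (x + y))) =
      (LINT x|lborel. ?k x * ?A x - \<phi>0 * (?k x * ?B x))"
    by (simp add: right_diff_distrib mult_ac)
  also have "\<dots> = (LINT x|lborel. ?k x * ?A x) - \<phi>0 * (LINT x|lborel. ?k x * ?B x)"
    using int[OF g_int] int[OF i] by simp
  finally show ?thesis
    unfolding gen_caputo_def 1 2 by simp
qed

text \<open>Carrying out the convolution exhibits f, below \<open>R\<close>, as the derivative of a
  single integrable function; linearity and the continuity bound can be read off from this.\<close>

lemma gen_caputo_eq_dD:
  assumes T: "0 < T" and \<gamma>: "0 < \<gamma>" "\<gamma> < 1" and \<phi>: "L1loc T \<phi>" and R: "0 < R" "ereal R < T"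
  obtains w where "integrable lborel w"
    "\<And>\<psi>. test_fun {..<R} \<psi> \<Longrightarrow> gen_caputo T \<gamma> \<phi> \<phi>0 \<psi> = dD (\<lambda>\<psi>. LINT x|lborel. w x * \<psi> x) \<psi>"
proof -
  obtain g where g: "borel_version R \<phi> g"
    using exists_borel_version[OF \<phi> R(2)] .
  let ?k = "trunc_ker R (1 - \<gamma>)" and ?u = "\<lambda>y. g y - \<phi>0 * indicator {0<..<R} y"
  have k: "integrable lborel ?k" and u: "integrable lborel ?u"
    using \<gamma> R(1) integrable_trunc_ker[of "1 - \<gamma>" R] borel_version_integrable[OF borel_version_diff_const[OF g]] by auto
  show thesis
  proof (rule that[OF integrable_conv(1)[OF k u]])
    fix \<psi> assume \<psi>: "test_fun {..<R} \<psi>"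
    then have \<psi>': "test_fun {..<R} (deriv \<psi>)"
      by (rule test_fun_deriv)
    obtain B where B: "\<And>x. \<bar>deriv \<psi> x\<bar> \<le> B"
      using test_fun_bounded[OF \<psi>'] by blast
    show "gen_caputo T \<gamma> \<phi> \<phi>0 \<psi> = dD (\<lambda>\<psi>. LINT z|lborel. (LINT x|lborel. ?k x * ?u (z - x)) * \<psi> z) \<psi>"
      unfolding gen_caputo_eq[OF T \<gamma> \<phi> R g \<psi>] dD_def
      using integral_translate_eq_conv[OF k u smooth_measurable[OF test_fun_smooth[OF \<psi>']] B] by simp
  qed
qed

lemma linear_on_tests_cong:
  assumes v: "linear_on_tests U v" and eq: "\<And>\<psi>. test_fun U \<psi> \<Longrightarrow> v' \<psi> = v \<psi>"
  shows "linear_on_tests U v'"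
  unfolding linear_on_tests_def
proof (intro allI impI)
  fix \<psi>1 \<psi>2 a b
  assume \<psi>: "test_fun U \<psi>1" "test_fun U \<psi>2"
  then have "v (\<lambda>x. a * \<psi>1 x + b * \<psi>2 x) = a * v \<psi>1 + b * v \<psi>2"
    using v unfolding linear_on_tests_def by blast
  then show "v' (\<lambda>x. a * \<psi>1 x + b * \<psi>2 x) = a * v' \<psi>1 + b * v' \<psi>2"
    by (simp only: eq[OF \<psi>(1)] eq[OF \<psi>(2)] eq[OF test_fun_lincomb[OF \<psi>]])
qed

lemma linear_on_tests_gen_caputo:
  assumes T: "0 < T" and \<gamma>: "0 < \<gamma>" "\<gamma> < 1" and \<phi>: "L1loc T \<phi>"
  shows "linear_on_tests (below T) (gen_caputo T \<gamma> \<phi> \<phi>0)"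
proof (rule linear_on_tests_below[OF T])
  fix R :: real assume R: "0 < R" "ereal R < T"
  obtain w where w: "integrable lborel w"
    "\<And>\<psi>. test_fun {..<R} \<psi> \<Longrightarrow> gen_caputo T \<gamma> \<phi> \<phi>0 \<psi> = dD (\<lambda>\<psi>. LINT x|lborel. w x * \<psi> x) \<psi>"
    using gen_caputo_eq_dD[OF T \<gamma> \<phi> R] by blast
  have "linear_on_tests {..<R} (dD (\<lambda>\<psi>. LINT x|lborel. w x * \<psi> x))"
    using w(1) by (intro linear_on_tests_dD linear_on_testsI_pairing) auto
  then show "linear_on_tests {..<R} (gen_caputo T \<gamma> \<phi> \<phi>0)"
    using w(2) by (rule linear_on_tests_cong)
qed

lemma dsupp_gen_caputo:
  assumes T: "0 < T" and \<gamma>: "0 < \<gamma>" "\<gamma> < 1" and \<phi>: "L1loc T \<phi>"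
  shows "dsupp (below T) (gen_caputo T \<gamma> \<phi> \<phi>0) \<subseteq> {0..}"
proof (rule dsupp_nonneg[OF T])
  fix \<psi> :: "real \<Rightarrow> real" assume \<psi>: "test_fun {..<0} \<psi>"
  obtain R where R: "0 < R" "ereal R < T"
    using T ereal_dense2[of 0 T] by (auto simp: zero_ereal_def)
  obtain g where g: "borel_version R \<phi> g"
    using exists_borel_version[OF \<phi> R(2)] .
  have \<psi>R: "test_fun {..<R} \<psi>"
    using \<psi> R(1) unfolding test_fun_def by (auto intro: order.strict_trans)
  have "trunc_ker R (1 - \<gamma>) x * (LINT y|lborel. (g y - \<phi>0 * indicator {0<..<R} y) * deriv \<psi> (x + y)) = 0" for x
  proof (cases "0 \<le> x")
    case True
    then have "(g y - \<phi>0 * indicator {0<..<R} y) * deriv \<psi> (x + y) = 0" for y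
      using zero_on_nonneg(2)[OF \<psi>, of "x + y"] borel_version_outside[OF borel_version_diff_const[OF g], of y]
      by (cases "0 \<le> y") (auto simp del: mult_eq_0_iff)
    then show ?thesis
      by (simp only: integral_zero mult_zero_right)
  next
    case False
    then show ?thesis
      by (simp add: trunc_ker_def)
  qed
  then show "gen_caputo T \<gamma> \<phi> \<phi>0 \<psi> = 0"
    unfolding gen_caputo_eq[OF T \<gamma> \<phi> R g \<psi>R] by (simp only: integral_zero minus_zero)
qed

lemma distribution_gen_caputo:
  assumes T: "0 < T" and \<gamma>: "0 < \<gamma>" "\<gamma> < 1" and \<phi>: "L1loc T \<phi>"
  shows "distribution (below T) (gen_caputo T \<gamma> \<phi> \<phi>0)"
  unfolding distribution_def
proof (intro conjI allI impI)
  fix K assume K: "compact K \<and> K \<subseteq> below T"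
  then obtain R where R: "0 < R" "ereal R < T" "K \<subseteq> {..<R}"
    using compact_below T by blast
  obtain w where w: "integrable lborel w"
    "\<And>\<psi>. test_fun {..<R} \<psi> \<Longrightarrow> gen_caputo T \<gamma> \<phi> \<phi>0 \<psi> = dD (\<lambda>\<psi>. LINT x|lborel. w x * \<psi> x) \<psi>"
    using gen_caputo_eq_dD[OF T \<gamma> \<phi> R(1,2)] by blast
  \<comment> \<open>Order 1 with the L1 norm of \<open>w\<close> as constant, because exactly one
    derivative falls on \<psi>; the supremum of \<psi> itself only enlarges the bound.\<close>
  have "\<bar>gen_caputo T \<gamma> \<phi> \<phi>0 \<psi>\<bar> \<le> (LINT x|lborel. \<bar>w x\<bar>) * (\<Sum>k\<le>1. SUP x. \<bar>(deriv ^^ k) \<psi> x\<bar>)"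
    if \<psi>: "test_fun (below T) \<psi> \<and> tsupp \<psi> \<subseteq> K" for \<psi>
  proof -
    have \<psi>R: "test_fun {..<R} \<psi>"
      using \<psi> R(3) test_fun_tsupp_mono by blast
    have bdd: "bdd_above (range (\<lambda>x. \<bar>\<xi> x\<bar>))" if \<xi>: "test_fun {..<R} \<xi>" for \<xi>
    proof -
      obtain B where "\<And>x. \<bar>\<xi> x\<bar> \<le> B"
        using test_fun_bounded[OF \<xi>] by blast
      then show ?thesis
        by (intro bdd_aboveI[of _ B]) auto
    qed
    have \<psi>': "test_fun {..<R} (deriv \<psi>)"
      using \<psi>R by (rule test_fun_deriv)
    let ?S0 = "SUP x. \<bar>\<psi> x\<bar>" and ?S1 = "SUP x. \<bar>deriv \<psi> x\<bar>"
    have S1: "\<bar>deriv \<psi> x\<bar> \<le> ?S1" for x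
      using bdd[OF \<psi>'] by (rule cSUP_upper[OF UNIV_I])
    have "0 \<le> \<bar>\<psi> 0\<bar>"
      by simp
    also have "\<dots> \<le> ?S0"
      using bdd[OF \<psi>R] by (rule cSUP_upper[OF UNIV_I])
    finally have S0: "0 \<le> ?S0" .
    have "\<bar>gen_caputo T \<gamma> \<phi> \<phi>0 \<psi>\<bar> = \<bar>LINT x|lborel. w x * deriv \<psi> (0 + x)\<bar>"
      using w(2)[OF \<psi>R] by (simp add: dD_def)
    also have "\<dots> \<le> (LINT x|lborel. \<bar>w x\<bar> * ?S1)"
      by (rule integral_translate_bounded[OF w(1) smooth_measurable[OF test_fun_smooth[OF \<psi>']] S1])
    also have "\<dots> = (LINT x|lborel. \<bar>w x\<bar>) * ?S1"
      by simp
    also have "\<dots> \<le> (LINT x|lborel. \<bar>w x\<bar>) * (?S0 + ?S1)"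
      using S0 by (intro mult_left_mono) auto
    also have "?S0 + ?S1 = (\<Sum>k\<le>1. SUP x. \<bar>(deriv ^^ k) \<psi> x\<bar>)"
      by simp
    finally show ?thesis .
  qed
  then show "\<exists>C N. \<forall>\<psi>. test_fun (below T) \<psi> \<and> tsupp \<psi> \<subseteq> K \<longrightarrow>
      \<bar>gen_caputo T \<gamma> \<phi> \<phi>0 \<psi>\<bar> \<le> C * (\<Sum>k\<le>N. SUP x. \<bar>(deriv ^^ k) \<psi> x\<bar>)"
    by blast
qed (use linear_on_tests_gen_caputo[OF assms] in \<open>auto simp: linear_on_tests_def\<close>)

section \<open>The fractional integral of the Caputo derivative\<close>

lemma deriv_cutoff_translate:
  assumes V: "open V" "{0..R} \<subseteq> V" "\<And>x. x \<in> V \<Longrightarrow> \<eta> x = 1"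
    and \<psi>: "test_fun {..<R} \<psi>" and x: "0 \<le> x" and z: "0 \<le> z"
  shows "deriv (\<lambda>y. \<eta> y * \<psi> (x + y)) z = deriv \<psi> (x + z)"
proof -
  obtain m where m: "m < R" "\<And>x. x > m \<Longrightarrow> \<psi> x = 0"
    using test_fun_lessThanD[OF \<psi>] by blast
  \<comment> \<open>\<open>z\<close> may exceed \<open>R\<close>, where nothing is known about
    \<eta>; but the translate already vanishes beyond m < R, so this open set contains every z >=
    0.\<close>
  let ?S = "V \<union> {m<..}"
  have "z \<in> ?S"
    using V(2) z m(1) by force
  have eq: "\<eta> y * \<psi> (x + y) = \<psi> (y + x)" if "y \<in> ?S" for y
    using that V(3)[of y] m(2)[of "x + y"] x by (cases "y \<in> V") (auto simp: add.commute)
  have "((\<lambda>y. \<psi> (y + x)) has_real_derivative deriv \<psi> (z + x)) (at z)"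
    using smooth_DERIV[OF test_fun_smooth[OF \<psi>], of "z + x"] by (simp add: DERIV_shift)
  then have "((\<lambda>y. \<eta> y * \<psi> (x + y)) has_real_derivative deriv \<psi> (z + x)) (at z)"
    by (rule has_field_derivative_transform_within_open[where S = ?S]) (use V(1) \<open>z \<in> ?S\<close> eq in auto)
  then show ?thesis
    by (simp add: DERIV_imp_deriv add.commute)
qed

text \<open>Both kernels act by translation averages on one function \<open>?P\<close>, so together
  they act as the indicator of (0, R) by \<open>trunc_ker_semigroup\<close>. Integrating \<psi>'
  over (0, R) then undoes the derivative, and what remains is the pairing with \<phi> -
  \<phi>0.\<close>

lemma J_gen_caputo:
  assumes T: "0 < T" and \<gamma>: "0 < \<gamma>" "\<gamma> < 1" and \<phi>: "L1loc T \<phi>"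
    and R: "0 < R" "ereal R < T" and g: "borel_version R \<phi> g" and \<psi>: "test_fun {..<R} \<psi>"
  shows "J T \<gamma> (gen_caputo T \<gamma> \<phi> \<phi>0) \<psi> = (LINT y|lborel. (g y - \<phi>0 * indicator {0<..<R} y) * \<psi> y)"
proof -
  let ?k = "trunc_ker R (1 - \<gamma>)" and ?u = "\<lambda>y. g y - \<phi>0 * indicator {0<..<R} y"
  let ?P = "\<lambda>z. LINT y|lborel. ?u y * deriv \<psi> (z + y)"
  have k: "integrable lborel ?k" and u: "integrable lborel ?u"
    using \<gamma> R(1) integrable_trunc_ker[of "1 - \<gamma>" R] borel_version_integrable[OF borel_version_diff_const[OF g]] by auto
  have u0: "?u y = 0" if "y < 0" for y
    using borel_version_outside[OF borel_version_diff_const[OF g], of y] that by simp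
  have \<psi>': "test_fun {..<R} (deriv \<psi>)"
    using \<psi> by (rule test_fun_deriv)
  have d [measurable]: "deriv \<psi> \<in> borel_measurable borel"
    by (rule smooth_measurable[OF test_fun_smooth[OF \<psi>']])
  have [measurable]: "?u \<in> borel_measurable borel" "?k \<in> borel_measurable borel"
    using borel_measurable_integrable[OF u] borel_measurable_integrable[OF k] by simp_all
  obtain B where B: "\<And>x. \<bar>deriv \<psi> x\<bar> \<le> B"
    using test_fun_bounded[OF \<psi>'] by blast
  have zero: "deriv \<psi> x = 0" if "R \<le> x" for x
    using deriv_zero_outside_tsupp[of x \<psi>] \<psi> that unfolding test_fun_def by force
  have P: "?P \<in> borel_measurable borel"
    by measurable
  have P0: "?P z = 0" if "R \<le> z" for z
    by (rule integral_translate_eq_0[OF u0 zero that])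
  obtain \<eta> V where \<eta>: "test_fun (below T) \<eta>" "open V" "{0..R} \<subseteq> V" "\<And>x. x \<in> V \<Longrightarrow> \<eta> x = 1"
    using exists_cutoff[OF R(2)] by blast
  have "J T \<gamma> (gen_caputo T \<gamma> \<phi> \<phi>0) \<psi> = gker \<gamma> (\<lambda>x. gen_caputo T \<gamma> \<phi> \<phi>0 (\<lambda>y. \<eta> y * \<psi> (x + y)))"
    by (rule J_eq[OF linear_on_tests_gen_caputo[OF T \<gamma> \<phi>] dsupp_gen_caputo[OF T \<gamma> \<phi>] \<eta> R(2) \<psi>])
  also have "\<dots> = gker \<gamma> (\<lambda>x. - (LINT x'|lborel. ?k x' * ?P (x + x')))"
  proof (rule gker_cong)
    fix x :: real assume x: "0 \<le> x"
    let ?p = "\<lambda>y. \<eta> y * \<psi> (x + y)"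
    have "test_fun {..<R} ?p"
      by (rule test_fun_translate_lessThan[OF \<eta>(1) \<psi> x])
    then have "gen_caputo T \<gamma> \<phi> \<phi>0 ?p = - (LINT x'|lborel. ?k x' * (LINT y|lborel. ?u y * deriv ?p (x' + y)))"
      by (rule gen_caputo_eq[OF T \<gamma> \<phi> R g])
    \<comment> \<open>The cutoff sits inside the derivative and must be removed there;
      \<open>?k\<close> and \<open>?u\<close> confine x' and y to where
      \<open>deriv_cutoff_translate\<close> applies.\<close>
    moreover have "?k x' * (LINT y|lborel. ?u y * deriv ?p (x' + y)) = ?k x' * ?P (x + x')" for x'
    proof (cases "0 \<le> x'")
      case True
      have "?u y * deriv ?p (x' + y) = ?u y * deriv \<psi> (x + x' + y)" for y
      proof (cases "0 \<le> y")
        case nonneg: True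
        then have "deriv ?p (x' + y) = deriv \<psi> (x + (x' + y))"
          using True by (intro deriv_cutoff_translate[OF \<eta>(2-4) \<psi> x] add_nonneg_nonneg)
        then show ?thesis
          by (simp only: add.assoc)
      next
        case False
        then show ?thesis
          using u0[of y] by (simp only: not_le mult_zero_left)
      qed
      then show ?thesis
        by (simp only:)
    next
      case False
      then show ?thesis
        by (simp add: trunc_ker_def)
    qed
    ultimately show "gen_caputo T \<gamma> \<phi> \<phi>0 ?p = - (LINT x'|lborel. ?k x' * ?P (x + x'))"
      by (simp only:)
  qed
  also have "\<dots> = (LINT x|lborel. trunc_ker R \<gamma> x * - (LINT x'|lborel. ?k x' * ?P (x + x')))"
  proof (rule gker_eq_trunc_ker[OF \<gamma>(1)])
    show "(\<lambda>x. - (LINT x'|lborel. ?k x' * ?P (x + x'))) \<in> borel_measurable borel"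
      using P by (intro borel_measurable_uminus measurable_integral_translate) simp_all
    show "- (LINT x'|lborel. ?k x' * ?P (x + x')) = 0" if "R \<le> x" for x
      using integral_translate_eq_0[of ?k R ?P x] P0 that by (simp add: trunc_ker_def)
  qed
  also have "\<dots> = - (LINT x|lborel. trunc_ker R \<gamma> x * (LINT x'|lborel. ?k x' * ?P (x + x')))"
    by simp
  \<comment> \<open>\<open>?P\<close> is admissible here: it is bounded, and it vanishes from
    \<open>R\<close> on because \<psi>' does and \<open>?u\<close> vanishes for negative y.\<close>
  also have "\<dots> = - (LINT z|lborel. indicator {0<..<R} z * ?P z)"
    using trunc_ker_semigroup[OF \<gamma> R(1) P integral_translate_bounded[OF u d B] P0] by simp
  also have "\<dots> = - (LINT y|lborel. ?u y * (LINT z|lborel. indicator {0<..<R} z * deriv \<psi> (z + y)))"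
    using fubini_translate[OF integrable_indicator_Ioo u d B] by simp
  also have "\<dots> = - (LINT y|lborel. - (?u y * \<psi> y))"
  proof -
    have "?u y * (LINT z|lborel. indicator {0<..<R} z * deriv \<psi> (z + y)) = - (?u y * \<psi> y)" for y
    proof (cases "0 \<le> y")
      case True
      then show ?thesis
        using integral_deriv_translate[OF \<psi> True R(1)] by (simp add: add.commute)
    next
      case False
      then show ?thesis
        using u0[of y] by (simp only: not_le mult_zero_left minus_zero)
    qed
    then show ?thesis
      by (simp only:)
  qed
  finally show ?thesis
    by simp
qed

text \<open>Exchanging the integrals first places \<open>g\<close> outside; translating afterwards
  puts the kernel at z - y, which is the Riemann-Liouville form.\<close>

lemma J_ext0_eq_conv:
  assumes T: "0 < T" and \<alpha>: "0 < \<alpha>" and h: "L1loc T h"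
    and R: "0 < R" "ereal R < T" and g: "borel_version R h g" and \<psi>: "test_fun {..<R} \<psi>"
  shows "J T \<alpha> (ext0 h) \<psi> = (LINT z|lborel. (LINT y|lborel. g y * trunc_ker R \<alpha> (z - y)) * \<psi> z)"
proof -
  note k = integrable_trunc_ker[OF \<alpha> R(1)] and g_int = borel_version_integrable[OF g]
  have m [measurable]: "\<psi> \<in> borel_measurable borel"
    by (rule smooth_measurable[OF test_fun_smooth[OF \<psi>]])
  obtain B where B: "\<And>x. \<bar>\<psi> x\<bar> \<le> B"
    using test_fun_bounded[OF \<psi>] by blast
  have zero: "\<psi> x = 0" if "R \<le> x" for x
    using zero_outside_tsupp[of x \<psi>] \<psi> that unfolding test_fun_def by force
  have "J T \<alpha> (ext0 h) \<psi> = (LINT x|lborel. trunc_ker R \<alpha> x * (LINT y|lborel. g y * \<psi> (x + y)))"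
    unfolding J_ext0[OF T h R(2) g \<psi>]
    using g_int borel_version_outside[OF g] zero
    by (intro gker_eq_trunc_ker \<alpha> measurable_integral_translate m integral_translate_eq_0[where R = R]) auto
  also have "\<dots> = (LINT y|lborel. g y * (LINT x|lborel. trunc_ker R \<alpha> x * \<psi> (y + x)))"
    unfolding fubini_translate[OF k g_int m B] by (simp only: add.commute)
  also have "\<dots> = (LINT z|lborel. (LINT y|lborel. g y * trunc_ker R \<alpha> (z - y)) * \<psi> z)"
    by (rule integral_translate_eq_conv[OF g_int k m B])
  finally show ?thesis .
qed

section \<open>From equal pairings to equality almost everywhere\<close>

lemma AE_lebesgue_below:
  assumes "\<And>R. 0 < R \<Longrightarrow> ereal R < T \<Longrightarrow> AE t in lborel. t \<in> {0<..<R} \<longrightarrow> P t"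
  shows "AE t in lebesgue. 0 < t \<and> ereal t < T \<longrightarrow> P t"
proof -
  \<comment> \<open>Rational endpoints leave countably many null sets, and some rational lies
    between t and T.\<close>
  have "AE t in lborel. \<forall>q::rat. 0 < real_of_rat q \<longrightarrow> ereal (real_of_rat q) < T \<longrightarrow> t \<in> {0<..<real_of_rat q} \<longrightarrow> P t"
    unfolding AE_all_countable using assms by fastforce
  then have "AE t in lborel. 0 < t \<and> ereal t < T \<longrightarrow> P t"
  proof eventually_elim
    case (elim t)
    show ?case
    proof
      assume t: "0 < t \<and> ereal t < T"
      then obtain q where q: "ereal t < ereal (real_of_rat q)" "ereal (real_of_rat q) < T"
        using ereal_dense3 by blast
      then have "t \<in> {0<..<real_of_rat q}" "0 < real_of_rat q"
        using t by (simp_all del: zero_less_of_rat_iff)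
      then show "P t"
        using elim q(2) by blast
    qed
  qed
  then show ?thesis
    by (rule AE_completion)
qed

lemma AE_eq_of_pairings_eq:
  assumes "integrable lborel v" "integrable lborel w"
    and eq: "\<And>\<psi>. test_fun {..<R} \<psi> \<Longrightarrow> (LINT x|lborel. v x * \<psi> x) = (LINT x|lborel. w x * \<psi> x)"
  shows "AE x in lborel. x \<in> {0<..<R} \<longrightarrow> v x = w x"
proof -
  have "AE x in lborel. x \<in> {0<..<R} \<longrightarrow> v x - w x = 0"
  proof (rule du_Bois_Reymond)
    show "integrable lborel (\<lambda>x. v x - w x)"
      using assms by simp
    fix \<psi> assume "test_fun {0<..<R} \<psi>"
    then have \<psi>: "test_fun {..<R} \<psi>"
      by (auto simp: test_fun_def)
    obtain B where B: "\<And>x. \<bar>\<psi> x\<bar> \<le> B"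
      using test_fun_bounded[OF \<psi>] by blast
    have "\<psi> \<in> borel_measurable lborel"
      using smooth_measurable[OF test_fun_smooth[OF \<psi>]] by simp
    note integrable_mult_bounded[OF assms(1) this B] integrable_mult_bounded[OF assms(2) this B]
    then show "(LINT x|lborel. (v x - w x) * \<psi> x) = 0"
      using eq[OF \<psi>] by (simp add: left_diff_distrib)
  qed
  then show ?thesis
    by simp
qed

text \<open>A distribution has pointwise values only through a representing function, and that only
  a.e.; hence the formula is claimed for every representative \<open>h\<close>.\<close>

lemma represents_AE_eq:
  assumes T: "0 < T" and \<gamma>: "0 < \<gamma>" "\<gamma> < 1" and \<phi>: "L1loc T \<phi>"
    and h: "represents T (J T \<gamma> (gen_caputo T \<gamma> \<phi> \<phi>0)) h"
  shows "AE t in lebesgue. 0 < t \<and> ereal t < T \<longrightarrow> \<phi> t = \<phi>0 + h t"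
proof (rule AE_lebesgue_below)
  fix R :: real
  assume R: "0 < R" "ereal R < T"
  obtain g where g: "borel_version R \<phi> g"
    using exists_borel_version[OF \<phi> R(2)] .
  obtain k where k: "borel_version R h k"
    using exists_borel_version[of T h, OF _ R(2)] h unfolding represents_def by blast
  note u = borel_version_diff_const[OF g, of \<phi>0]
  have "(LINT x|lborel. k x * \<psi> x) = (LINT x|lborel. (g x - \<phi>0 * indicator {0<..<R} x) * \<psi> x)"
    if \<psi>: "test_fun {..<R} \<psi>" for \<psi>
  proof -
    obtain m where m: "m < R" "\<And>x. x > m \<Longrightarrow> \<psi> x = 0"
      using test_fun_lessThanD[OF \<psi>] by blast
    have "(LINT x|lborel. k x * \<psi> x) = ext0 h \<psi>"
      using m by (intro ext0_eq[OF k smooth_measurable[OF test_fun_smooth[OF \<psi>]], symmetric]) simp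
    also have "\<dots> = J T \<gamma> (gen_caputo T \<gamma> \<phi> \<phi>0) \<psi>"
      using h test_fun_below_lessThan[OF R(2) \<psi>] unfolding represents_def by simp
    finally show ?thesis
      unfolding J_gen_caputo[OF T \<gamma> \<phi> R g \<psi>] .
  qed
  then have "AE x in lborel. x \<in> {0<..<R} \<longrightarrow> k x = g x - \<phi>0 * indicator {0<..<R} x"
    by (rule AE_eq_of_pairings_eq[OF borel_version_integrable[OF k] borel_version_integrable[OF u]])
  moreover have "AE x in lborel. x \<in> {0..R} \<longrightarrow> k x = h x" "AE x in lborel. x \<in> {0..R} \<longrightarrow> g x = \<phi> x"
    using k g by (simp_all add: borel_version_def)
  ultimately show "AE t in lborel. t \<in> {0<..<R} \<longrightarrow> \<phi> t = \<phi>0 + h t"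
    by eventually_elim auto
qed

text \<open>Provides the representative without which the formula for all representatives could be
  vacuous.\<close>

lemma represents_J_gen_caputo:
  assumes T: "0 < T" and \<gamma>: "0 < \<gamma>" "\<gamma> < 1" and \<phi>: "L1loc T \<phi>"
  shows "represents T (J T \<gamma> (gen_caputo T \<gamma> \<phi> \<phi>0)) (\<lambda>t. \<phi> t - \<phi>0)"
  unfolding represents_def
proof (intro conjI allI impI)
  show "L1loc T (\<lambda>t. \<phi> t - \<phi>0)"
    unfolding L1loc_def
  proof (intro allI impI set_integral_diff(1))
    fix K
    assume K: "compact K \<and> K \<subseteq> {t. 0 \<le> t \<and> ereal t < T}"
    then show "set_integrable lebesgue K \<phi>"
      using \<phi> unfolding L1loc_def by (elim allE impE)
    show "set_integrable lebesgue K (\<lambda>t. \<phi>0)"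
      using K lmeasurable_compact absolutely_integrable_on_const by blast
  qed
next
  fix \<psi>
  assume "test_fun (below T) \<psi>"
  then obtain R where R: "0 < R" "ereal R < T" and \<psi>: "test_fun {..<R} \<psi>"
    using test_fun_belowE T by blast
  obtain g where g: "borel_version R \<phi> g"
    using exists_borel_version[OF \<phi> R(2)] .
  obtain m where m: "m < R" "\<And>x. x > m \<Longrightarrow> \<psi> x = 0"
    using test_fun_lessThanD[OF \<psi>] by blast
  show "J T \<gamma> (gen_caputo T \<gamma> \<phi> \<phi>0) \<psi> = ext0 (\<lambda>t. \<phi> t - \<phi>0) \<psi>"
    unfolding J_gen_caputo[OF T \<gamma> \<phi> R g \<psi>]
    using m by (intro ext0_eq[OF borel_version_diff_const[OF g] smooth_measurable[OF test_fun_smooth[OF \<psi>]], symmetric]) simp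
qed

text \<open>\<open>f\<close> and \<open>ext0 F\<close> agree on test functions only, and
  \<open>J\<close> evaluates them on cutoff translates, which are test functions for every
  x.\<close>

lemma J_represented:
  assumes T: "0 < T" and f: "represents T f F" and R: "ereal R < T" and \<psi>: "test_fun {..<R} \<psi>"
    and lin: "linear_on_tests (below T) f" and supp: "dsupp (below T) f \<subseteq> {0..}"
  shows "J T \<alpha> f \<psi> = J T \<alpha> (ext0 F) \<psi>"
proof -
  have F: "L1loc T F"
    using f by (simp add: represents_def)
  obtain \<eta> V where \<eta>: "test_fun (below T) \<eta>" "open V" "{0..R} \<subseteq> V" "\<And>x. x \<in> V \<Longrightarrow> \<eta> x = 1"
    using exists_cutoff[OF R] by blast
  have "f (\<lambda>y. \<eta> y * \<psi> (x + y)) = ext0 F (\<lambda>y. \<eta> y * \<psi> (x + y))" for x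
    using f test_fun_translate_mult[OF \<eta>(1) test_fun_smooth[OF \<psi>], of x] unfolding represents_def by blast
  moreover have "J T \<alpha> f \<psi> = gker \<alpha> (\<lambda>x. f (\<lambda>y. \<eta> y * \<psi> (x + y)))"
    by (rule J_eq[OF lin supp \<eta> R \<psi>])
  moreover have "J T \<alpha> (ext0 F) \<psi> = gker \<alpha> (\<lambda>x. ext0 F (\<lambda>y. \<eta> y * \<psi> (x + y)))"
    by (rule J_eq[OF linear_on_tests_ext0[OF T F] dsupp_ext0[OF T] \<eta> R \<psi>])
  ultimately show ?thesis
    by (simp only:)
qed

text \<open>For 0 <= s < t < R the argument t - s lies in (0, R), so the truncated kernel is the
  full one up to the factor \<Gamma>(\<alpha>).\<close>

lemma trunc_ker_integral:
  assumes \<alpha>: "0 < \<alpha>" and k: "borel_version R F k" and t: "0 < t" "t < R"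
    and int: "integrable lborel (\<lambda>y. k y * trunc_ker R \<alpha> (t - y))"
  shows "set_integrable lebesgue {0..t} (\<lambda>s. (t - s) powr (\<alpha> - 1) * F s)"
    and "(LINT y|lborel. k y * trunc_ker R \<alpha> (t - y)) =
      1 / Gamma \<alpha> * (LINT s:{0..t}|lebesgue. (t - s) powr (\<alpha> - 1) * F s)"
proof -
  have Gamma: "Gamma \<alpha> \<noteq> 0"
    using Gamma_real_pos[OF \<alpha>] by simp
  let ?K = "\<lambda>y. k y * trunc_ker R \<alpha> (t - y)"
  let ?I = "\<lambda>s. indicator {0..t} s *\<^sub>R ((t - s) powr (\<alpha> - 1) * F s)"
  have F [measurable]: "(\<lambda>x. indicator {0..R} x * F x) \<in> borel_measurable lebesgue"
    using k by (simp add: borel_version_def)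
  have [measurable]: "(\<lambda>s. indicator {0..t} s * (t - s) powr (\<alpha> - 1)) \<in> borel_measurable lebesgue"
    by (rule measurable_completion) measurable
  have K: "?K \<in> borel_measurable lborel"
    using int by simp
  have "?I = (\<lambda>s. (indicator {0..t} s * (t - s) powr (\<alpha> - 1)) * (indicator {0..R} s * F s))"
    using t by (auto simp: indicator_def)
  then have I: "?I \<in> borel_measurable lebesgue"
    by simp
  have "AE s in lborel. s \<in> {0..R} \<longrightarrow> k s = F s"
    using k by (simp add: borel_version_def)
  then have "AE s in lborel. ?I s = Gamma \<alpha> * ?K s"
  proof eventually_elim
    case (elim s)
    \<comment> \<open>At s = t both sides vanish: \<open>0 powr\<close> is 0, and the truncated
      kernel is 0 at the origin.\<close>
    consider "s < 0" | "0 \<le> s" "s < t" | "s = t" | "t < s"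
      by linarith
    then show ?case
      by cases (use elim t Gamma borel_version_outside[OF k, of s] in \<open>auto simp: trunc_ker_def\<close>)
  qed
  then have ae: "AE s in lebesgue. ?I s = Gamma \<alpha> * ?K s"
    by (rule AE_completion)
  have K': "?K \<in> borel_measurable lebesgue"
    using K by (rule measurable_completion)
  have "integrable lebesgue (\<lambda>s. Gamma \<alpha> * ?K s)"
    using int K by (simp add: integrable_completion)
  then show "set_integrable lebesgue {0..t} (\<lambda>s. (t - s) powr (\<alpha> - 1) * F s)"
    unfolding set_integrable_def using integrable_cong_AE[OF I _ ae] K' by simp
  have "(LINT s:{0..t}|lebesgue. (t - s) powr (\<alpha> - 1) * F s) = (LINT s|lebesgue. Gamma \<alpha> * ?K s)"
    unfolding set_lebesgue_integral_def using K' by (intro integral_cong_AE I ae) simp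
  also have "\<dots> = Gamma \<alpha> * (LINT s|lborel. ?K s)"
    using integral_completion[OF K] by simp
  finally show "(LINT y|lborel. ?K y) = 1 / Gamma \<alpha> * (LINT s:{0..t}|lebesgue. (t - s) powr (\<alpha> - 1) * F s)"
    using Gamma by simp
qed

text \<open>Computing the fractional integral of f once from its Caputo form and once from
  \<open>F\<close> gives two integrable densities with equal pairings. Integrability is asserted
  along with the formula, since the integral of a nonintegrable function would be a mere default
  value.\<close>

lemma gen_caputo_represented_AE:
  assumes T: "0 < T" and \<gamma>: "0 < \<gamma>" "\<gamma> < 1" and \<phi>: "L1loc T \<phi>"
    and F: "represents T (gen_caputo T \<gamma> \<phi> \<phi>0) F"
  shows "AE t in lebesgue. 0 < t \<and> ereal t < T \<longrightarrow>
    set_integrable lebesgue {0..t} (\<lambda>s. (t - s) powr (\<gamma> - 1) * F s) \<and>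
    \<phi> t = \<phi>0 + 1 / Gamma \<gamma> * (LINT s:{0..t}|lebesgue. (t - s) powr (\<gamma> - 1) * F s)"
proof (rule AE_lebesgue_below)
  fix R :: real
  assume R: "0 < R" "ereal R < T"
  have F_loc: "L1loc T F"
    using F by (simp add: represents_def)
  obtain g where g: "borel_version R \<phi> g"
    using exists_borel_version[OF \<phi> R(2)] .
  obtain k where k: "borel_version R F k"
    using exists_borel_version[OF F_loc R(2)] .
  note u = borel_version_diff_const[OF g, of \<phi>0]
  note conv = integrable_conv[OF borel_version_integrable[OF k] integrable_trunc_ker[OF \<gamma>(1) R(1)]]
  have "(LINT x|lborel. (LINT y|lborel. k y * trunc_ker R \<gamma> (x - y)) * \<psi> x) =
      (LINT x|lborel. (g x - \<phi>0 * indicator {0<..<R} x) * \<psi> x)"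
    if \<psi>: "test_fun {..<R} \<psi>" for \<psi>
    using J_gen_caputo[OF T \<gamma> \<phi> R g \<psi>] J_ext0_eq_conv[OF T \<gamma>(1) F_loc R k \<psi>]
      J_represented[OF T F R(2) \<psi> linear_on_tests_gen_caputo[OF T \<gamma> \<phi>] dsupp_gen_caputo[OF T \<gamma> \<phi>]]
    by metis
  then have "AE x in lborel. x \<in> {0<..<R} \<longrightarrow>
      (LINT y|lborel. k y * trunc_ker R \<gamma> (x - y)) = g x - \<phi>0 * indicator {0<..<R} x"
    by (rule AE_eq_of_pairings_eq[OF conv(1) borel_version_integrable[OF u]])
  moreover have "AE x in lborel. x \<in> {0..R} \<longrightarrow> g x = \<phi> x"
    using g by (simp add: borel_version_def)
  ultimately show "AE t in lborel. t \<in> {0<..<R} \<longrightarrow>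
      set_integrable lebesgue {0..t} (\<lambda>s. (t - s) powr (\<gamma> - 1) * F s) \<and>
      \<phi> t = \<phi>0 + 1 / Gamma \<gamma> * (LINT s:{0..t}|lebesgue. (t - s) powr (\<gamma> - 1) * F s)"
    using conv(2)
  proof eventually_elim
    case (elim t)
    show ?case
    proof
      assume t: "t \<in> {0<..<R}"
      then have *: "0 < t" "t < R"
        by simp_all
      show "set_integrable lebesgue {0..t} (\<lambda>s. (t - s) powr (\<gamma> - 1) * F s) \<and>
          \<phi> t = \<phi>0 + 1 / Gamma \<gamma> * (LINT s:{0..t}|lebesgue. (t - s) powr (\<gamma> - 1) * F s)"
        using trunc_ker_integral[OF \<gamma>(1) k * elim(3)] elim(1,2) t by (simp add: indicator_def)
    qed
  qed
qed

theorem theorem3p7: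
  fixes T :: ereal and \<gamma> \<phi>0 :: real and \<phi> :: "real \<Rightarrow> real" and f :: distr
  assumes "0 < T" and "0 < \<gamma>" and "\<gamma> < 1"
    and "L1loc T \<phi>"
    and "f = gen_caputo T \<gamma> \<phi> \<phi>0"
  shows "distribution (below T) f \<and> dsupp (below T) f \<subseteq> {0..} \<and>
    (\<exists>h. represents T (J T \<gamma> f) h) \<and>
    (\<forall>h. represents T (J T \<gamma> f) h \<longrightarrow>
       (AE t in lebesgue. 0 < t \<and> ereal t < T \<longrightarrow> \<phi> t = \<phi>0 + h t)) \<and>
    (\<forall>F. represents T f F \<longrightarrow>
       (AE t in lebesgue. 0 < t \<and> ereal t < T \<longrightarrow>
          set_integrable lebesgue {0..t} (\<lambda>s. (t - s) powr (\<gamma> - 1) * F s) \<and>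
          \<phi> t = \<phi>0 + 1 / Gamma \<gamma> *
            (LINT s:{0..t}|lebesgue. (t - s) powr (\<gamma> - 1) * F s)))"
  unfolding assms(5)
  using distribution_gen_caputo[OF assms(1-4)] dsupp_gen_caputo[OF assms(1-4)]
    represents_J_gen_caputo[OF assms(1-4)] represents_AE_eq[OF assms(1-4)]
    gen_caputo_represented_AE[OF assms(1-4)]
  by blast

end
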